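(* Let $(\Omega,\Sigma,\mu)$ be a measure space, $1 \le p < \infty$, let $q$ be the dual exponent ($\frac1p+\frac1q=1$), let $O \subseteq \mathbb{C}^d$ be open and non-empty, and let $f : O \times \Omega \to \mathbb{C}$ be a function with the following properties: \begin{itemize} \item for every $z \in O$ the function $F(z) := f(z,\cdot)$ is measurable, and $\displaystyle \sup_{z \in O} \int_\Omega |f(z,t)|^p \, \mu(\mathrm{d}t) < \infty$; \item for every $t \in \Omega$ the function $f_t := f(\cdot,t)$ is bounded and holomorphic on $O$. \end{itemize} Fix $\alpha \in \mathbb{N}_0^d$, $a \in O$, and a bp-continuous linear functional $\varphi : \mathrm{H}^\infty(O) \to \mathbb{C}$. Then the following assertions hold: (a) $F \in \mathrm{H}^\infty(O; \mathrm{L}_p(\Omega))$ and $D^\alpha F(a) = D_z^\alpha f(a,\cdot)$ $\mu$-almost everywhere. (b) For each $h \in \mathrm{L}_q(\Omega)$ the function $z \mapsto \int_\Omega f(z,t) h(t)\, \mu(\mathrm{d}t)$ is holomorphic on $O$ and \[ D^\alpha \Bigl( z \mapsto \int_\Omega f(z,t)h(t)\,\mu(\mathrm{d}t) \Bigr) = \Bigl( z \mapsto \int_\Omega D_z^\alpha f(z,t) h(t)\, \mu(\mathrm{d}t) \Bigr). \] (c) The function $t \mapsto \varphi(f_t)$, $\Omega \to \mathbb{C}$, is measurable and $p$-integrable with \[ \Bigl( \int_\Omega |\varphi(f_t)|^p\, \mu(\mathrm{d}t) \Bigr)^{1/p} \le \|\varphi\| \sup_{z \in O} \|F(z)\|_p,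 \] and it is contained in the subspace $\overline{\mathrm{span}}\,F(O) \subseteq \mathrm{L}_p(\Omega)$. (d) For all $h \in \mathrm{L}_q(\Omega)$: \[ \int_\Omega \varphi(f_t) h(t)\, \mu(\mathrm{d}t) = \varphi\Bigl( z \mapsto \int_\Omega f(z,t) h(t)\, \mu(\mathrm{d}t) \Bigr). \]
   Context: Functions in $\mathrm{L}_p(\Omega)=\mathrm{L}_p(\Omega,\Sigma,\mu)$ are complex-valued and identified when equal $\mu$-almost everywhere; $F(z)$ is regarded as the corresponding element of $\mathrm{L}_p(\Omega)$ where appropriate. $\overline{\mathrm{span}}$ denotes the norm-closed linear span. A function from an open set $O \subseteq \mathbb{C}^d$ to a complex Banach space $E$ is holomorphic if it is Fréchet-differentiable with $\mathbb{C}$-linear derivative at each point of $O$. $\mathrm{H}^\infty(O;E)$ is the space of all bounded holomorphic functions $O \to E$ with the supremum norm, and $\mathrm{H}^\infty(O) := \mathrm{H}^\infty(O;\mathbb{C})$. For $\alpha \in \mathbb{N}_0^d$, $D^\alpha = \prod_{j=1}^d \partial^{\alpha_j}/\partial z_j^{\alpha_j}$ is the iterated complex partial derivative, and $D_z^\alpha f(a,t) := D^\alpha(f(\cdot,t))(a)$. A sequence $(g_n)_n$ of bounded functions on $O$ bp-converges to $g$ if $g_n \to g$ pointwise on $O$ and $\sup_n \|g_n\|_\infty < \infty$. A linear functional $\varphi : \mathrm{H}^\infty(O) \to \mathbb{C}$ is bp-continuous if $\varphi(g_n) \to \varphi(g)$ whenever $(g_n)_n$ is a sequence in $\mathrm{H}^\infty(O)$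 that bp-converges to $g \in \mathrm{H}^\infty(O)$. Such a functional is in particular norm-bounded, and $\|\varphi\|$ is its norm as a functional on $\mathrm{H}^\infty(O)$ with the supremum norm. *)

theory Defs
  imports "HOL-Analysis.Analysis"
begin

section \<open>Lebesgue spaces of complex-valued functions\<close>

definition Lp_fun :: "'a measure \<Rightarrow> real \<Rightarrow> ('a \<Rightarrow> complex) set" where
  "Lp_fun M p = {u \<in> borel_measurable M. integrable M (\<lambda>t. norm (u t) powr p)}"

definition Linf_fun :: "'a measure \<Rightarrow> ('a \<Rightarrow> complex) set" where
  "Linf_fun M = {u \<in> borel_measurable M. \<exists>C. AE t in M. norm (u t) \<le> C}"

definition Lq_fun :: "'a measure \<Rightarrow> ennreal \<Rightarrow> ('a \<Rightarrow> complex) set" where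
  "Lq_fun M q = (if q = \<infinity> then Linf_fun M else Lp_fun M (enn2real q))"

definition Lp_seminorm :: "'a measure \<Rightarrow> real \<Rightarrow> ('a \<Rightarrow> complex) \<Rightarrow> real" where
  "Lp_seminorm M p u = (\<integral>t. norm (u t) powr p \<partial>M) powr (1 / p)"

text \<open>The elements of \<open>Lp M p\<close> are equivalence classes of functions modulo equality almost
  everywhere.  The space depends on the terms \<open>M\<close> and \<open>p\<close>, so it is a carrier set
  with explicit operations rather than a type.\<close>

definition Lp_eq :: "'a measure \<Rightarrow> real \<Rightarrow> (('a \<Rightarrow> complex) \<times> ('a \<Rightarrow> complex)) set" where
  "Lp_eq M p = {(u, v). u \<in> Lp_fun M p \<and> v \<in> Lp_fun M p \<and> (AE t in M. u t = v t)}"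

definition Lp :: "'a measure \<Rightarrow> real \<Rightarrow> ('a \<Rightarrow> complex) set set" where
  "Lp M p = Lp_fun M p // Lp_eq M p"

definition Lp_class :: "'a measure \<Rightarrow> real \<Rightarrow> ('a \<Rightarrow> complex) \<Rightarrow> ('a \<Rightarrow> complex) set" where
  "Lp_class M p u = Lp_eq M p `` {u}"

definition Lp_add :: "'a measure \<Rightarrow> real \<Rightarrow> ('a \<Rightarrow> complex) set \<Rightarrow> ('a \<Rightarrow> complex) set \<Rightarrow> ('a \<Rightarrow> complex) set" where
  "Lp_add M p A B = (\<Union>u\<in>A. \<Union>v\<in>B. Lp_class M p (\<lambda>t. u t + v t))"

definition Lp_scale :: "'a measure \<Rightarrow> real \<Rightarrow> complex \<Rightarrow> ('a \<Rightarrow> complex) set \<Rightarrow> ('a \<Rightarrow> complex) set" where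
  "Lp_scale M p c A = (\<Union>u\<in>A. Lp_class M p (\<lambda>t. c * u t))"

definition Lp_diff :: "'a measure \<Rightarrow> real \<Rightarrow> ('a \<Rightarrow> complex) set \<Rightarrow> ('a \<Rightarrow> complex) set \<Rightarrow> ('a \<Rightarrow> complex) set" where
  "Lp_diff M p A B = Lp_add M p A (Lp_scale M p (-1) B)"

definition Lp_norm :: "'a measure \<Rightarrow> real \<Rightarrow> ('a \<Rightarrow> complex) set \<Rightarrow> real" where
  "Lp_norm M p A = Lp_seminorm M p (SOME u. u \<in> A)"

definition Lp_subspace :: "'a measure \<Rightarrow> real \<Rightarrow> ('a \<Rightarrow> complex) set set \<Rightarrow> bool" where
  "Lp_subspace M p V \<longleftrightarrow> V \<subseteq> Lp M p \<and> Lp_class M p (\<lambda>_. 0) \<in> V \<and>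
     (\<forall>A\<in>V. \<forall>B\<in>V. Lp_add M p A B \<in> V) \<and> (\<forall>c. \<forall>A\<in>V. Lp_scale M p c A \<in> V)"

definition Lp_closed_span :: "'a measure \<Rightarrow> real \<Rightarrow> ('a \<Rightarrow> complex) set set \<Rightarrow> ('a \<Rightarrow> complex) set set" where
  "Lp_closed_span M p S =
     {A \<in> Lp M p. \<forall>\<epsilon>>0. \<exists>B \<in> Lp_subspace M p hull S. Lp_norm M p (Lp_diff M p A B) < \<epsilon>}"


section \<open>Holomorphic functions of several complex variables\<close>

text \<open>The index type \<open>'d\<close> of \<open>complex ^ 'd\<close> is finite and linearly ordered, so it stands
  for \<open>{1, \<dots>, d}\<close>.  A multi-index is a function \<open>'d \<Rightarrow> nat\<close>; for \<open>\<alpha>\<close> the partial derivative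
  with respect to the first coordinate is the outermost one.\<close>

definition iterate_partials ::
    "('d::{finite,linorder} \<Rightarrow> 'f \<Rightarrow> 'f) \<Rightarrow> ('d \<Rightarrow> nat) \<Rightarrow> 'f \<Rightarrow> 'f" where
  "iterate_partials P \<alpha> G = foldr (\<lambda>j H. (P j ^^ \<alpha> j) H) (sorted_list_of_set UNIV) G"

definition holomorphic_vec :: "(complex ^ 'd \<Rightarrow> complex) \<Rightarrow> (complex ^ 'd) set \<Rightarrow> bool" where
  "holomorphic_vec g U \<longleftrightarrow>
     (\<forall>z\<in>U. \<exists>D. (g has_derivative D) (at z) \<and> (\<forall>c v. D (c *s v) = c * D v))"

definition cpartial :: "'d \<Rightarrow> (complex ^ 'd \<Rightarrow> complex) \<Rightarrow> complex ^ 'd \<Rightarrow> complex" where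
  "cpartial j g = (\<lambda>z. deriv (\<lambda>s. g (z + axis j s)) 0)"

definition cpartials :: "('d::{finite,linorder} \<Rightarrow> nat) \<Rightarrow> ((complex, 'd) vec \<Rightarrow> complex) \<Rightarrow> (complex, 'd) vec \<Rightarrow> complex" where
  "cpartials \<alpha> g = iterate_partials cpartial \<alpha> g"

text \<open>Functions on \<open>U\<close> are represented by total functions, whose values outside \<open>U\<close> are
  irrelevant.\<close>

definition Hinf :: "(complex ^ 'd) set \<Rightarrow> (complex ^ 'd \<Rightarrow> complex) set" where
  "Hinf U = {g. holomorphic_vec g U \<and> bounded (g ` U)}"

definition sup_norm :: "(complex ^ 'd) set \<Rightarrow> (complex ^ 'd \<Rightarrow> complex) \<Rightarrow> real" where
  "sup_norm U g = (SUP z\<in>U. norm (g z))"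

definition Lp_linear :: "'a measure \<Rightarrow> real \<Rightarrow> (complex ^ 'd \<Rightarrow> ('a \<Rightarrow> complex) set) \<Rightarrow> bool" where
  "Lp_linear M p D \<longleftrightarrow> (\<forall>v. D v \<in> Lp M p) \<and>
     (\<forall>v w. D (v + w) = Lp_add M p (D v) (D w)) \<and>
     (\<forall>c v. D (c *s v) = Lp_scale M p c (D v))"

definition holomorphic_Lp ::
    "'a measure \<Rightarrow> real \<Rightarrow> (complex ^ 'd \<Rightarrow> ('a \<Rightarrow> complex) set) \<Rightarrow> (complex ^ 'd) set \<Rightarrow> bool" where
  "holomorphic_Lp M p G U \<longleftrightarrow> (\<forall>z\<in>U. G z \<in> Lp M p) \<and>
     (\<forall>z\<in>U. \<exists>D. Lp_linear M p D \<and> (\<exists>K. \<forall>v. Lp_norm M p (D v) \<le> K * norm v) \<and>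
       ((\<lambda>v. Lp_norm M p (Lp_diff M p (Lp_diff M p (G (z + v)) (G z)) (D v)) / norm v)
          \<longlongrightarrow> 0) (at 0))"

definition Hinf_Lp ::
    "'a measure \<Rightarrow> real \<Rightarrow> (complex ^ 'd) set \<Rightarrow> (complex ^ 'd \<Rightarrow> ('a \<Rightarrow> complex) set) set" where
  "Hinf_Lp M p U = {G. holomorphic_Lp M p G U \<and> bounded ((\<lambda>z. Lp_norm M p (G z)) ` U)}"

definition Lp_partial ::
    "'a measure \<Rightarrow> real \<Rightarrow> 'd \<Rightarrow> (complex ^ 'd \<Rightarrow> ('a \<Rightarrow> complex) set) \<Rightarrow>
     complex ^ 'd \<Rightarrow> ('a \<Rightarrow> complex) set" where
  "Lp_partial M p j G = (\<lambda>z. THE A. A \<in> Lp M p \<and>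
     ((\<lambda>s. Lp_norm M p
         (Lp_diff M p (Lp_scale M p (inverse s) (Lp_diff M p (G (z + axis j s)) (G z))) A))
       \<longlongrightarrow> 0) (at 0))"

definition Lp_partials ::
    "'a measure \<Rightarrow> real \<Rightarrow> ('d::{finite,linorder} \<Rightarrow> nat) \<Rightarrow>
     ((complex, 'd) vec \<Rightarrow> ('a \<Rightarrow> complex) set) \<Rightarrow> (complex, 'd) vec \<Rightarrow> ('a \<Rightarrow> complex) set" where
  "Lp_partials M p \<alpha> G = iterate_partials (Lp_partial M p) \<alpha> G"


section \<open>Functionals on the space of bounded holomorphic functions\<close>

definition bp_converges ::
    "(complex ^ 'd) set \<Rightarrow> (nat \<Rightarrow> complex ^ 'd \<Rightarrow> complex) \<Rightarrow> (complex ^ 'd \<Rightarrow> complex) \<Rightarrow> bool" where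
  "bp_converges U g l \<longleftrightarrow> (\<forall>z\<in>U. (\<lambda>n. g n z) \<longlonglongrightarrow> l z) \<and> (\<exists>C. \<forall>n. \<forall>z\<in>U. norm (g n z) \<le> C)"

definition Hinf_linear :: "(complex ^ 'd) set \<Rightarrow> ((complex ^ 'd \<Rightarrow> complex) \<Rightarrow> complex) \<Rightarrow> bool" where
  "Hinf_linear U \<phi> \<longleftrightarrow>
     (\<forall>g\<in>Hinf U. \<forall>h\<in>Hinf U. \<phi> (\<lambda>z. g z + h z) = \<phi> g + \<phi> h) \<and>
     (\<forall>c. \<forall>g\<in>Hinf U. \<phi> (\<lambda>z. c * g z) = c * \<phi> g)"

definition bp_continuous :: "(complex ^ 'd) set \<Rightarrow> ((complex ^ 'd \<Rightarrow> complex) \<Rightarrow> complex) \<Rightarrow> bool" where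
  "bp_continuous U \<phi> \<longleftrightarrow> (\<forall>g l. (\<forall>n. g n \<in> Hinf U) \<longrightarrow> l \<in> Hinf U \<longrightarrow> bp_converges U g l \<longrightarrow>
     (\<lambda>n. \<phi> (g n)) \<longlonglongrightarrow> \<phi> l)"

text \<open>A functional is a function of total functions, but a bp-continuous one is well defined
  on \<open>H\<^sup>\<infinity>(U)\<close>: constant sequences show that it only sees the restriction to \<open>U\<close>.\<close>

lemma bp_continuous_cong:
  assumes "bp_continuous U \<phi>" "g \<in> Hinf U" "h \<in> Hinf U" "\<And>z. z \<in> U \<Longrightarrow> g z = h z"
  shows "\<phi> g = \<phi> h"
proof -
  obtain C where "\<forall>z\<in>U. norm (g z) \<le> C"
    using assms(2) by (auto simp: Hinf_def bounded_iff)
  then have "bp_converges U (\<lambda>_. g) h"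
    using assms(4) by (auto simp: bp_converges_def)
  then have "(\<lambda>_::nat. \<phi> g) \<longlonglongrightarrow> \<phi> h"
    using assms(1-3) by (simp add: bp_continuous_def)
  then show ?thesis
    by (simp add: LIMSEQ_const_iff)
qed

definition Hinf_functional_norm :: "(complex ^ 'd) set \<Rightarrow> ((complex ^ 'd \<Rightarrow> complex) \<Rightarrow> complex) \<Rightarrow> real" where
  "Hinf_functional_norm U \<phi> = (SUP g\<in>{g \<in> Hinf U. sup_norm U g \<le> 1}. norm (\<phi> g))"


section \<open>The operations on classes are computed on representatives\<close>

lemma Lp_fun_scale: "u \<in> Lp_fun M p \<Longrightarrow> (\<lambda>t. c * u t) \<in> Lp_fun M p"
  by (auto simp: Lp_fun_def norm_mult powr_mult)

lemma Lp_fun_add: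
  assumes p: "0 < p" and u: "u \<in> Lp_fun M p" and v: "v \<in> Lp_fun M p"
  shows "(\<lambda>t. u t + v t) \<in> Lp_fun M p"
proof -
  have [measurable]: "u \<in> borel_measurable M" "v \<in> borel_measurable M"
    using u v by (auto simp: Lp_fun_def)
  have bound: "norm (x + y) powr p \<le> 2 powr p * (norm x powr p + norm y powr p)" for x y :: complex
  proof -
    have "norm (x + y) powr p \<le> (2 * max (norm x) (norm y)) powr p"
      using norm_triangle_ineq[of x y] p by (intro powr_mono2) auto
    also have "\<dots> = 2 powr p * max (norm x) (norm y) powr p"
      by (simp add: powr_mult)
    also have "\<dots> \<le> 2 powr p * (norm x powr p + norm y powr p)"
      by (intro mult_left_mono) (auto simp: max_def)
    finally show ?thesis .
  qed
  have "integrable M (\<lambda>t. 2 powr p * (norm (u t) powr p + norm (v t) powr p))"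
    using u v by (auto simp: Lp_fun_def)
  then have "integrable M (\<lambda>t. norm (u t + v t) powr p)"
    by (rule Bochner_Integration.integrable_bound) (use bound in auto)
  then show ?thesis by (simp add: Lp_fun_def)
qed

lemma equiv_Lp_eq: "equiv (Lp_fun M p) (Lp_eq M p)"
proof (rule equivI)
  show "trans (Lp_eq M p)"
  proof (rule transI)
    fix u v w assume uv: "(u, v) \<in> Lp_eq M p" and vw: "(v, w) \<in> Lp_eq M p"
    then have "AE t in M. u t = v t" "AE t in M. v t = w t"
      by (auto simp: Lp_eq_def)
    then have "AE t in M. u t = w t"
      by eventually_elim simp
    then show "(u, w) \<in> Lp_eq M p"
      using uv vw by (auto simp: Lp_eq_def)
  qed
  show "sym (Lp_eq M p)"
  proof (rule symI)
    fix u v assume uv: "(u, v) \<in> Lp_eq M p"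
    then have "AE t in M. u t = v t"
      by (auto simp: Lp_eq_def)
    then have "AE t in M. v t = u t"
      by eventually_elim simp
    then show "(v, u) \<in> Lp_eq M p"
      using uv by (auto simp: Lp_eq_def)
  qed
qed (auto simp: refl_on_def Lp_eq_def)

lemma Lp_class_self: "u \<in> Lp_fun M p \<Longrightarrow> u \<in> Lp_class M p u"
  by (simp add: Lp_class_def Lp_eq_def)

lemma Lp_class_in_Lp: "u \<in> Lp_fun M p \<Longrightarrow> Lp_class M p u \<in> Lp M p"
  by (simp add: Lp_class_def Lp_def quotientI)

lemma Lp_class_eq_iff:
  assumes "u \<in> Lp_fun M p" "v \<in> Lp_fun M p"
  shows "Lp_class M p u = Lp_class M p v \<longleftrightarrow> (AE t in M. u t = v t)"
  using eq_equiv_class_iff[OF equiv_Lp_eq assms] assms unfolding Lp_class_def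
  by (simp add: Lp_eq_def)

lemma mem_Lp_class_iff:
  "v \<in> Lp_class M p u \<longleftrightarrow> u \<in> Lp_fun M p \<and> v \<in> Lp_fun M p \<and> (AE t in M. u t = v t)"
  by (simp add: Lp_class_def Lp_eq_def)

lemma Lp_scale_class:
  assumes u: "u \<in> Lp_fun M p"
  shows "Lp_scale M p c (Lp_class M p u) = Lp_class M p (\<lambda>t. c * u t)"
proof -
  have "Lp_class M p (\<lambda>t. c * v t) = Lp_class M p (\<lambda>t. c * u t)" if v: "v \<in> Lp_class M p u" for v
  proof (subst Lp_class_eq_iff)
    have "AE t in M. u t = v t"
      using v by (simp add: mem_Lp_class_iff)
    then show "AE t in M. c * v t = c * u t"
      by eventually_elim simp
  qed (use v in \<open>auto simp: mem_Lp_class_iff Lp_fun_scale\<close>)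
  then show ?thesis
    using Lp_class_self[OF u] unfolding Lp_scale_def by blast
qed

lemma Lp_add_class:
  assumes p: "0 < p" and u: "u \<in> Lp_fun M p" and v: "v \<in> Lp_fun M p"
  shows "Lp_add M p (Lp_class M p u) (Lp_class M p v) = Lp_class M p (\<lambda>t. u t + v t)"
proof -
  have "Lp_class M p (\<lambda>t. u' t + v' t) = Lp_class M p (\<lambda>t. u t + v t)"
    if "u' \<in> Lp_class M p u" "v' \<in> Lp_class M p v" for u' v'
  proof (subst Lp_class_eq_iff)
    have "AE t in M. u t = u' t" "AE t in M. v t = v' t"
      using that by (simp_all add: mem_Lp_class_iff)
    then show "AE t in M. u' t + v' t = u t + v t"
      by eventually_elim simp
  qed (use that p in \<open>auto simp: mem_Lp_class_iff intro!: Lp_fun_add\<close>)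
  then show ?thesis
    using Lp_class_self[OF u] Lp_class_self[OF v] unfolding Lp_add_def by blast
qed

lemma Lp_diff_class:
  assumes "0 < p" "u \<in> Lp_fun M p" "v \<in> Lp_fun M p"
  shows "Lp_diff M p (Lp_class M p u) (Lp_class M p v) = Lp_class M p (\<lambda>t. u t - v t)"
  using Lp_add_class[OF assms(1,2) Lp_fun_scale[OF assms(3), of "-1"]] assms(3)
  by (simp add: Lp_diff_def Lp_scale_class)

lemma Lp_norm_class:
  assumes u: "u \<in> Lp_fun M p"
  shows "Lp_norm M p (Lp_class M p u) = Lp_seminorm M p u"
proof -
  define w where "w = (SOME v. v \<in> Lp_class M p u)"
  have "w \<in> Lp_class M p u"
    unfolding w_def using Lp_class_self[OF u] by (rule someI[of "\<lambda>v. v \<in> Lp_class M p u"])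
  then have w: "w \<in> Lp_fun M p" and ae: "AE t in M. u t = w t"
    by (simp_all add: mem_Lp_class_iff)
  have [measurable]: "u \<in> borel_measurable M" "w \<in> borel_measurable M"
    using u w by (simp_all add: Lp_fun_def)
  have "AE t in M. norm (w t) powr p = norm (u t) powr p"
    using ae by eventually_elim simp
  then have "(\<integral>t. norm (w t) powr p \<partial>M) = (\<integral>t. norm (u t) powr p \<partial>M)"
    by (intro integral_cong_AE) measurable
  then show ?thesis
    by (simp add: Lp_norm_def Lp_seminorm_def w_def)
qed

end

theory Submission
  imports Defs "HOL-Complex_Analysis.Cauchy_Integral_Formula"
begin

text \<open>
  The proof rests on one fact about a bp-continuous functional \<open>\<phi>\<close> on the bounded holomorphic functions: it is
  a norm limit of finite combinations \<open>\<psi> g = \<Sum>k<N. c k * g (x k)\<close> of point evaluations (lemma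
  \<open>bp_continuous_approximation\<close>).  Such combinations arise from a penalised maximisation over the unit
  ball: if \<open>g\<close> nearly maximises \<open>Re (\<phi> g) - N (\<Sum>k<N. \<bar>g (x k)\<bar>\<^sup>2)\<close>, where \<open>x\<close> is a dense sequence, then the
  first-order condition at \<open>g\<close> says that \<open>\<phi>\<close> is close to the gradient of the penalty, which is a combination of
  evaluations, up to an error \<open>\<bar>\<phi> g\<bar>\<close>; and \<open>g\<close> tends boundedly and pointwise to \<open>0\<close> as \<open>N\<close> grows.

  For a combination \<open>\<psi>\<close> of evaluations, \<open>t \<mapsto> \<psi> (f(\<cdot>, t))\<close> is a linear combination of the functions \<open>F (x k)\<close>, so it
  lies in the span of \<open>F(U)\<close> and its integral against \<open>h\<close> is \<open>\<psi>\<close> applied to \<open>z \<mapsto> \<integral>t. f z t * h t \<partial>M\<close>.  This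
  function is holomorphic (\<open>pairing_holomorphic\<close>) and is bounded by the norm of \<open>h\<close> times the supremum of \<open>\<parallel>F\<parallel>\<close>.
  Testing against a norming \<open>h\<close> (\<open>norming_dual_fun\<close>) shows that the norm of \<open>t \<mapsto> \<psi> (f(\<cdot>, t))\<close> in \<open>L\<^sub>p\<close> is at most
  the functional norm of \<open>\<psi>\<close> times the supremum of \<open>\<parallel>F\<parallel>\<close>.  This is a bound independent of the coefficients, so norm
  convergence of the functionals forces convergence in \<open>L\<^sub>p\<close>, and everything passes to \<open>\<phi>\<close>
  (\<open>functional_of_family\<close>).

  The differentiability of \<open>F\<close> follows by taking for \<open>\<phi>\<close> the functional \<open>g \<mapsto> g (z + v) - g z - Dg(z) v\<close>.
  By Cauchy's inequalities on complex lines its norm is \<open>O(\<bar>v\<bar>\<^sup>2)\<close>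
  (\<open>bounded_holomorphic_vec_estimates\<close>), and it is bp-continuous because derivatives converge along bounded
  pointwise convergent sequences (\<open>bounded_pointwise_limit\<close>).  A partial derivative of \<open>f\<close> satisfies
  the hypotheses on smaller balls, so that derivatives of higher order are reached by
  iteration.
\<close>


section \<open>Quantitative differentiability of bounded holomorphic functions\<close>

text \<open>Cauchy's inequalities bound the first two derivatives of \<open>h\<close> on the disc of radius \<open>R / 2\<close>, where every
point is the centre of a disc of radius \<open>R / 2\<close> on which \<open>h\<close> is bounded by \<open>B\<close>.  Taylor's formula on
that disc then gives the increments.\<close>

lemma bounded_holomorphic_estimates:
  fixes h :: "complex \<Rightarrow> complex"
  assumes hol: "h holomorphic_on ball 0 R" and bound: "\<And>s. norm s < R \<Longrightarrow> norm (h s) \<le> B"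
    and s: "norm s < R / 2" and R: "0 < R"
  shows "norm (deriv h 0) \<le> 2 * B / R"
    and "norm (h s - h 0) \<le> 2 * B / R * norm s"
    and "norm (h s - h 0 - deriv h 0 * s) \<le> 8 * B / R\<^sup>2 * (norm s)\<^sup>2"
proof -
  have der: "((deriv ^^ n) h has_field_derivative deriv ((deriv ^^ n) h) x) (at x within ball 0 (R/2))"
    if "x \<in> ball 0 (R/2)" for n x
  proof -
    have "(deriv ^^ n) h holomorphic_on ball 0 R"
      by (intro holomorphic_higher_deriv hol) auto
    then show ?thesis
      using holomorphic_derivI[of _ "ball 0 R" x] that R by (auto intro: has_field_derivative_at_within)
  qed
  have cauchy: "norm ((deriv ^^ n) h x) \<le> fact n * B / (R/2)^n" if "x \<in> ball 0 (R/2)" for n x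
  proof (rule Cauchy_inequality)
    have sub: "cball x (R/2) \<subseteq> ball 0 R"
      using that by (simp add: cball_subset_ball_iff dist_norm)
    have hol': "h holomorphic_on cball x (R/2)"
      using hol sub by (rule holomorphic_on_subset)
    then show "continuous_on (cball x (R/2)) h"
      by (rule holomorphic_on_imp_continuous_on)
    show "h holomorphic_on ball x (R/2)"
      using hol' by (rule holomorphic_on_subset) auto
    show "norm (h y) \<le> B" if "norm (x - y) = R/2" for y
      using sub that by (intro bound) (auto simp: dist_norm subset_iff)
  qed (use R in auto)
  have s': "s \<in> ball 0 (R/2)" "0 \<in> ball (0::complex) (R/2)"
    using s R by auto
  show "norm (deriv h 0) \<le> 2 * B / R"
    using cauchy[OF s'(2), of 1] by (simp add: field_simps)
  have "norm ((deriv ^^ 0) h s - (\<Sum>i\<le>0. (deriv ^^ i) h 0 * (s - 0)^i / fact i))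
      \<le> (2 * B / R) * norm (s - 0)^(Suc 0) / fact 0"
    by (rule complex_Taylor[where S = "ball 0 (R / 2)" and f = "\<lambda>i. (deriv ^^ i) h"])
      (use der[of _ 0] cauchy[of _ 1] s' in \<open>simp_all add: mult.commute\<close>)
  then show "norm (h s - h 0) \<le> 2 * B / R * norm s"
    by simp
  have "norm ((deriv ^^ 0) h s - (\<Sum>i\<le>1. (deriv ^^ i) h 0 * (s - 0)^i / fact i))
      \<le> (8 * B / R\<^sup>2) * norm (s - 0)^(Suc 1) / fact 1"
    by (rule complex_Taylor[where S = "ball 0 (R / 2)" and f = "\<lambda>i. (deriv ^^ i) h"])
      (use der cauchy[of _ 2] s' in \<open>simp_all add: power2_eq_square numeral_2_eq_2\<close>)
  then show "norm (h s - h 0 - deriv h 0 * s) \<le> 8 * B / R\<^sup>2 * (norm s)\<^sup>2"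
    by (simp add: algebra_simps power2_eq_square)
qed

abbreviation cD :: "(complex ^ 'd \<Rightarrow> complex) \<Rightarrow> complex ^ 'd \<Rightarrow> complex ^ 'd \<Rightarrow> complex" where
  "cD g z \<equiv> frechet_derivative g (at z)"

lemma norm_vector_scale: "norm (c *s (v :: complex ^ 'd)) = norm c * norm v"
  by (simp add: norm_vec_def norm_mult L2_set_right_distrib)

lemma axis_eq_scale: "axis j s = s *s (axis j 1 :: complex ^ 'd)"
  by (simp add: vec_eq_iff axis_def)

lemma norm_axis_complex: "norm (axis j s :: complex ^ 'd) = norm s"
proof -
  have "norm (axis j s :: complex ^ 'd) = L2_set (\<lambda>i. if i = j then norm s else 0) UNIV"
    unfolding norm_vec_def by (intro L2_set_cong) (auto simp: axis_def)
  also have "\<dots> = norm s"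
    by (simp add: L2_set_def if_distrib[of "\<lambda>x. x\<^sup>2"] sum.delta cong: if_cong)
  finally show ?thesis .
qed

lemma linear_vector_scale: "bounded_linear (\<lambda>s. s *s (v :: complex ^ 'd))"
  by (intro bounded_linear_intro[where K = "norm v"]) (auto simp: vec_eq_iff algebra_simps norm_vector_scale)

lemma
  assumes "holomorphic_vec g U" "z \<in> U"
  shows holomorphic_vec_has_derivative: "(g has_derivative cD g z) (at z)"
    and cD_scale: "cD g z (c *s v) = c * cD g z v"
    and cD_add: "cD g z (v + w) = cD g z v + cD g z w"
proof -
  obtain D where D: "(g has_derivative D) (at z)" "\<forall>c v. D (c *s v) = c * D v"
    using assms by (auto simp: holomorphic_vec_def)
  have eq: "D = cD g z"
    using D(1) by (rule frechet_derivative_at)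
  show "(g has_derivative cD g z) (at z)" "cD g z (c *s v) = c * cD g z v"
    using D unfolding eq by auto
  then show "cD g z (v + w) = cD g z v + cD g z w"
    using has_derivative_linear linear_add by blast
qed

lemma holomorphic_vec_line:
  assumes "holomorphic_vec g U" "z + s *s v \<in> U"
  shows "((\<lambda>s. g (z + s *s v)) has_field_derivative cD g (z + s *s v) v) (at s)"
proof -
  have "((\<lambda>s. z + s *s v) has_derivative (\<lambda>s. s *s v)) (at s)"
    using has_derivative_add[OF has_derivative_const bounded_linear_imp_has_derivative[OF linear_vector_scale]]
    by fastforce
  then have "((\<lambda>s. g (z + s *s v)) has_derivative (\<lambda>x. cD g (z + s *s v) (x *s v))) (at s)"
    using holomorphic_vec_has_derivative[OF assms] by (rule has_derivative_compose)
  moreover have "(\<lambda>x. cD g (z + s *s v) (x *s v)) = (*) (cD g (z + s *s v) v)"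
    by (rule ext) (simp add: cD_scale[OF assms])
  ultimately show ?thesis
    unfolding has_field_derivative_def by simp
qed

lemma cpartial_eq_cD:
  assumes "holomorphic_vec g U" "z \<in> U"
  shows "cpartial j g z = cD g z (axis j 1)"
  using holomorphic_vec_line[OF assms(1), of z 0 "axis j 1"] assms(2)
  unfolding cpartial_def by (subst axis_eq_scale) (auto intro!: DERIV_imp_deriv)

text \<open>The fundamental estimate: the error of the linear approximation is quadratic in \<open>v\<close>, with a constant
that depends on \<open>g\<close> only through a bound for \<open>\<bar>g\<bar>\<close>.  It therefore holds uniformly on bounded sets of
functions.  All three bounds follow from the one-variable ones along the complex line \<open>s \<mapsto> z + s v\<close>.\<close>

lemma bounded_holomorphic_vec_estimates:
  fixes g :: "complex ^ 'd \<Rightarrow> complex"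
  assumes hol: "holomorphic_vec g U" and sub: "ball z r \<subseteq> U" and r: "0 < r"
    and bound: "\<And>w. w \<in> ball z r \<Longrightarrow> norm (g w) \<le> B"
  shows "norm (cD g z v) \<le> 2 * B / r * norm v"
    and "norm v < r / 2 \<Longrightarrow> norm (g (z + v) - g z) \<le> 2 * B / r * norm v"
    and "norm v < r / 2 \<Longrightarrow> norm (g (z + v) - g z - cD g z v) \<le> 8 * B / r\<^sup>2 * (norm v)\<^sup>2"
proof -
  have "norm (cD g z v) \<le> 2 * B / r * norm v \<and>
    (norm v < r / 2 \<longrightarrow> norm (g (z + v) - g z) \<le> 2 * B / r * norm v \<and>
      norm (g (z + v) - g z - cD g z v) \<le> 8 * B / r\<^sup>2 * (norm v)\<^sup>2)"
  proof (cases "v = 0")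
    case True
    have "cD g z 0 = 0"
      using cD_scale[OF hol, of z 0 0] sub r by (auto simp: subset_iff)
    then show ?thesis
      using True by simp
  next
    case False
    \<comment> \<open>With this radius the line stays in the ball, and the point of interest is \<open>s = 1\<close>.\<close>
    define R where "R = r / norm v"
    define h where "h = (\<lambda>s. g (z + s *s v))"
    have R: "0 < R"
      using False r by (simp add: R_def)
    have mem: "z + s *s v \<in> ball z r" if "norm s < R" for s
      using that False by (simp add: dist_norm R_def norm_vector_scale field_simps)
    have der: "(h has_field_derivative cD g (z + s *s v) v) (at s)" if "norm s < R" for s
      using holomorphic_vec_line[OF hol, of z s v] mem[OF that] sub by (auto simp: h_def)
    then have "h holomorphic_on ball 0 R"
      unfolding holomorphic_on_def field_differentiable_def
      using has_field_derivative_at_within by fastforce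
    moreover have "norm (h s) \<le> B" if "norm s < R" for s
      using bound[OF mem[OF that]] by (simp add: h_def)
    moreover have "deriv h 0 = cD g z v"
      using der[of 0] R by (auto intro: DERIV_imp_deriv)
    moreover have "norm (1::complex) < R / 2" if "norm v < r / 2"
      using that False by (simp add: R_def field_simps)
    moreover have "2 * B / R = 2 * B / r * norm v" "8 * B / R\<^sup>2 = 8 * B / r\<^sup>2 * (norm v)\<^sup>2"
      by (simp_all add: R_def power_divide)
    moreover have "norm (0::complex) < R / 2"
      using R by simp
    ultimately show ?thesis
      using bounded_holomorphic_estimates(1)[of h R B 0] bounded_holomorphic_estimates(2-3)[of h R B 1] R
      by (simp add: h_def)
  qed
  then show "norm (cD g z v) \<le> 2 * B / r * norm v"
    and "norm v < r / 2 \<Longrightarrow> norm (g (z + v) - g z) \<le> 2 * B / r * norm v"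
    and "norm v < r / 2 \<Longrightarrow> norm (g (z + v) - g z - cD g z v) \<le> 8 * B / r\<^sup>2 * (norm v)\<^sup>2"
    by auto
qed

text \<open>Conversely, a quadratic error estimate determines the derivative.  A statement of this form survives
pointwise limits and integration over a parameter, which the definition of the derivative does not.\<close>

lemma has_derivativeI_quadratic:
  fixes g D :: "complex ^ 'd \<Rightarrow> complex"
  assumes add: "\<And>v w. D (v + w) = D v + D w" and scale: "\<And>c v. D (c *s v) = c * D v"
    and r: "0 < r" and quad: "\<And>v. norm v < r \<Longrightarrow> norm (g (z + v) - g z - D v) \<le> K * (norm v)\<^sup>2"
  shows "(g has_derivative D) (at z)"
proof -
  have "D (c *\<^sub>R v) = c *\<^sub>R D v" for c v
  proof -
    have "c *\<^sub>R v = of_real c *s v"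
      by (simp add: vec_eq_iff) (simp add: scaleR_conv_of_real)
    then show ?thesis
      by (simp add: scale) (simp add: scaleR_conv_of_real)
  qed
  then have lin: "bounded_linear D"
    using add by (simp add: linear_conv_bounded_linear[symmetric] linearI)
  have "((\<lambda>v. norm (g (z + v) - g z - D v) / norm v) \<longlongrightarrow> 0) (at 0)"
  proof (rule Lim_null_comparison)
    have "\<forall>\<^sub>F v in at (0 :: complex ^ 'd). norm v < r"
      using r by (auto simp: eventually_at intro!: exI[of _ r])
    then show "\<forall>\<^sub>F v in at 0. norm (norm (g (z + v) - g z - D v) / norm v) \<le> K * norm v"
    proof eventually_elim
      case (elim v)
      then show ?case
        using quad[OF elim] by (cases "v = 0") (auto simp: field_simps power2_eq_square)
    qed
    show "((\<lambda>v. K * norm v) \<longlongrightarrow> 0) (at (0 :: complex ^ 'd))"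
      by (auto intro!: tendsto_eq_intros)
  qed
  then show ?thesis
    using lin by (simp add: has_derivative_at)
qed


section \<open>Limits of bounded sequences of holomorphic functions\<close>

lemma HinfI:
  assumes "holomorphic_vec g U" "\<And>z. z \<in> U \<Longrightarrow> norm (g z) \<le> B"
  shows "g \<in> Hinf U"
  using assms by (auto simp: Hinf_def bounded_iff)

lemma small_scale_exists:
  fixes a b c d :: real
  assumes "0 \<le> a" "0 < b" "0 \<le> c" "0 < d"
  obtains s where "0 < s" "s * a < b" "s * c < d"
proof -
  have "\<forall>\<^sub>F s in at_right 0. s * a < b" "\<forall>\<^sub>F s in at_right 0. s * c < d"
    using assms(2,4) by (auto intro!: order_tendstoD(2)[of _ 0] tendsto_eq_intros)
  moreover have "\<forall>\<^sub>F s::real in at_right 0. 0 < s"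
    by (auto simp: eventually_at_filter)
  ultimately have "\<forall>\<^sub>F s in at_right 0. 0 < s \<and> s * a < b \<and> s * c < d"
    by eventually_elim auto
  then have "\<exists>s. 0 < s \<and> s * a < b \<and> s * c < d"
    using eventually_happens trivial_limit_at_right_real by blast
  then show ?thesis
    using that by blast
qed

text \<open>A Vitali-type theorem without local uniformity: the quadratic estimate says that difference quotients
approximate derivatives uniformly in the index \<open>n\<close>.  The quotients converge, as they only involve
values, and so the derivatives form a Cauchy sequence.  The estimate then passes to the limit.\<close>

lemma bounded_pointwise_limit:
  fixes g :: "nat \<Rightarrow> complex ^ 'd \<Rightarrow> complex"
  assumes U: "open U" and hol: "\<And>n. holomorphic_vec (g n) U"
    and bound: "\<And>n z. z \<in> U \<Longrightarrow> norm (g n z) \<le> B"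
    and lim: "\<And>z. z \<in> U \<Longrightarrow> (\<lambda>n. g n z) \<longlonglongrightarrow> G z"
  shows "holomorphic_vec G U" and "z \<in> U \<Longrightarrow> (\<lambda>n. cD (g n) z v) \<longlonglongrightarrow> cD G z v"
proof -
  have main: "\<exists>D. (G has_derivative D) (at z) \<and> (\<forall>c v. D (c *s v) = c * D v) \<and>
      (\<forall>v. (\<lambda>n. cD (g n) z v) \<longlonglongrightarrow> D v)" if z: "z \<in> U" for z
  proof -
    obtain r where r: "0 < r" "ball z r \<subseteq> U"
      using U z open_contains_ball by blast
    define K where "K = 8 * B / r\<^sup>2"
    have quad: "norm (g n (z + v) - g n z - cD (g n) z v) \<le> K * (norm v)\<^sup>2" if "norm v < r / 2" for n v
      unfolding K_def using bounded_holomorphic_vec_estimates(3)[OF hol r(2,1) _ that] bound r(2) by blast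
    have mem: "z + v \<in> U" if "norm v < r / 2" for v
      using that r by (auto simp: subset_iff dist_norm)
    have B: "0 \<le> B"
      using bound[OF z, of 0] norm_ge_zero[of "g 0 z"] by linarith
    have K: "0 \<le> K"
      using B by (simp add: K_def)
    have "Cauchy (\<lambda>n. cD (g n) z v)" for v
    proof (rule metric_CauchyI)
      fix \<epsilon> :: real assume \<epsilon>: "0 < \<epsilon>"
      \<comment> \<open>The difference quotient \<open>a n\<close> with step \<open>s\<close> differs from the derivative by at most \<open>s K \<bar>v\<bar>\<^sup>2\<close>, which is
        paid twice; the other \<open>\<epsilon> / 2\<close> is for the convergence of the quotients.\<close>
      obtain s where s: "0 < s" "s * norm v < r / 2" "s * (2 * K * (norm v)\<^sup>2) < \<epsilon> / 2"
        using small_scale_exists[of "norm v" "r / 2" "2 * K * (norm v)\<^sup>2" "\<epsilon> / 2"] r(1) \<epsilon> K by auto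
      define u where "u = of_real s *s v"
      define a where "a = (\<lambda>n. (g n (z + u) - g n z) / of_real s)"
      have u: "norm u < r / 2"
        using s by (simp add: u_def norm_vector_scale)
      have a: "norm (a n - cD (g n) z v) \<le> s * (K * (norm v)\<^sup>2)" for n
      proof -
        have "a n - cD (g n) z v = (g n (z + u) - g n z - cD (g n) z u) / of_real s"
          using s(1) by (simp add: a_def u_def cD_scale[OF hol z] field_simps)
        also have "norm \<dots> \<le> K * (norm u)\<^sup>2 / s"
          using quad[OF u, of n] s(1) by (simp add: norm_divide divide_right_mono)
        also have "\<dots> = s * (K * (norm v)\<^sup>2)"
          using s(1) by (simp add: u_def norm_vector_scale power2_eq_square)
        finally show ?thesis .
      qed
      have "convergent a"
        unfolding a_def convergent_def using s(1)
        by (intro exI[of _ "(G (z + u) - G z) / of_real s"] tendsto_divide tendsto_diff lim z mem u tendsto_const) auto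
      then have "Cauchy a"
        by (simp add: Cauchy_convergent_iff)
      then obtain N where N: "\<And>m n. N \<le> m \<Longrightarrow> N \<le> n \<Longrightarrow> dist (a m) (a n) < \<epsilon> / 2"
        using \<epsilon> metric_CauchyD[of a "\<epsilon> / 2"] by auto
      show "\<exists>M. \<forall>m\<ge>M. \<forall>n\<ge>M. dist (cD (g m) z v) (cD (g n) z v) < \<epsilon>"
      proof (intro exI[of _ N] allI impI)
        fix m n assume mn: "N \<le> m" "N \<le> n"
        have "dist (cD (g m) z v) (cD (g n) z v)
            \<le> norm (a m - cD (g m) z v) + norm (a n - cD (g n) z v) + dist (a m) (a n)"
          by (simp only: dist_norm) norm
        then show "dist (cD (g m) z v) (cD (g n) z v) < \<epsilon>"
          using a[of m] a[of n] N[OF mn] s(3) by linarith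
      qed
    qed
    then have "\<exists>l. (\<lambda>n. cD (g n) z v) \<longlonglongrightarrow> l" for v
      by (simp add: Cauchy_convergent_iff convergent_def)
    then obtain D where D: "\<And>v. (\<lambda>n. cD (g n) z v) \<longlonglongrightarrow> D v"
      by metis
    have add: "D (v + w) = D v + D w" for v w
      using LIMSEQ_unique[OF D[of "v + w"], of "D v + D w"] tendsto_add[OF D[of v] D[of w]]
      by (simp add: cD_add[OF hol z])
    have scale: "D (c *s v) = c * D v" for c v
      using LIMSEQ_unique[OF D[of "c *s v"], of "c * D v"] tendsto_mult_left[OF D[of v], of c]
      by (simp add: cD_scale[OF hol z])
    have "norm (G (z + v) - G z - D v) \<le> K * (norm v)\<^sup>2" if v: "norm v < r / 2" for v
    proof (rule LIMSEQ_le_const2)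
      show "(\<lambda>n. norm (g n (z + v) - g n z - cD (g n) z v)) \<longlonglongrightarrow> norm (G (z + v) - G z - D v)"
        by (intro tendsto_norm tendsto_diff lim D z mem v)
    qed (use quad[OF v] in auto)
    then have "(G has_derivative D) (at z)"
      using r(1) by (intro has_derivativeI_quadratic[where r = "r / 2"] add scale) auto
    then show ?thesis
      using scale D by blast
  qed
  show "holomorphic_vec G U"
    using main by (fastforce simp: holomorphic_vec_def)
  show "(\<lambda>n. cD (g n) z v) \<longlonglongrightarrow> cD G z v" if "z \<in> U"
    using main[OF that] frechet_derivative_at by fastforce
qed

lemma holomorphic_vec_subset: "holomorphic_vec g U \<Longrightarrow> V \<subseteq> U \<Longrightarrow> holomorphic_vec g V"
  by (auto simp: holomorphic_vec_def)

lemma holomorphic_vec_add: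
  assumes "holomorphic_vec g U" "holomorphic_vec h U"
  shows "holomorphic_vec (\<lambda>z. g z + h z) U"
  unfolding holomorphic_vec_def
proof
  fix z assume z: "z \<in> U"
  show "\<exists>D. ((\<lambda>z. g z + h z) has_derivative D) (at z) \<and> (\<forall>c v. D (c *s v) = c * D v)"
    using has_derivative_add[OF assms[THEN holomorphic_vec_has_derivative, OF z]]
    by (intro exI[of _ "\<lambda>v. cD g z v + cD h z v"])
      (simp add: cD_scale[OF assms(1) z] cD_scale[OF assms(2) z] algebra_simps)
qed

lemma holomorphic_vec_cmult:
  assumes "holomorphic_vec g U"
  shows "holomorphic_vec (\<lambda>z. c * g z) U"
  unfolding holomorphic_vec_def
proof
  fix z assume z: "z \<in> U"
  show "\<exists>D. ((\<lambda>z. c * g z) has_derivative D) (at z) \<and> (\<forall>c v. D (c *s v) = c * D v)"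
    using has_derivative_mult_right[OF holomorphic_vec_has_derivative[OF assms z], of c]
    by (intro exI[of _ "\<lambda>v. c * cD g z v"]) (simp add: cD_scale[OF assms z])
qed

lemma holomorphic_vec_shift:
  assumes "holomorphic_vec g U" "\<And>z. z \<in> V \<Longrightarrow> z + v \<in> U"
  shows "holomorphic_vec (\<lambda>z. g (z + v)) V"
  unfolding holomorphic_vec_def
proof
  fix z assume z: "z \<in> V"
  have "((\<lambda>z. z + v) has_derivative (\<lambda>x. x)) (at z)"
    by (auto intro!: derivative_eq_intros)
  then have "((\<lambda>z. g (z + v)) has_derivative cD g (z + v)) (at z)"
    using has_derivative_compose holomorphic_vec_has_derivative[OF assms(1) assms(2)[OF z]] by blast
  then show "\<exists>D. ((\<lambda>z. g (z + v)) has_derivative D) (at z) \<and> (\<forall>c v. D (c *s v) = c * D v)"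
    using cD_scale[OF assms(1) assms(2)[OF z]] by blast
qed

lemma Hinf_obtain_bound:
  assumes "g \<in> Hinf U"
  obtains B where "0 \<le> B" "\<And>z. z \<in> U \<Longrightarrow> norm (g z) \<le> B"
proof -
  obtain B where "\<And>z. z \<in> U \<Longrightarrow> norm (g z) \<le> B"
    using assms by (auto simp: Hinf_def bounded_iff)
  then show ?thesis
    using that[of "max B 0"] by (auto simp: le_max_iff_disj)
qed

lemma Hinf_add:
  assumes "g \<in> Hinf U" "h \<in> Hinf U" shows "(\<lambda>z. g z + h z) \<in> Hinf U"
proof -
  obtain A B where "\<And>z. z \<in> U \<Longrightarrow> norm (g z) \<le> A" "\<And>z. z \<in> U \<Longrightarrow> norm (h z) \<le> B"
    using Hinf_obtain_bound[OF assms(1)] Hinf_obtain_bound[OF assms(2)] by metis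
  then show ?thesis
    using assms
    by (intro HinfI[where B = "A + B"] holomorphic_vec_add norm_triangle_mono) (auto simp: Hinf_def)
qed

lemma Hinf_cmult:
  assumes "g \<in> Hinf U" shows "(\<lambda>z. c * g z) \<in> Hinf U"
proof -
  obtain A where "\<And>z. z \<in> U \<Longrightarrow> norm (g z) \<le> A"
    using Hinf_obtain_bound[OF assms] by metis
  then show ?thesis
    using assms
    by (intro HinfI[where B = "norm c * A"] holomorphic_vec_cmult) (auto simp: Hinf_def norm_mult mult_left_mono)
qed

text \<open>A partial derivative is the pointwise limit of difference quotients, which are holomorphic and, by the
fundamental estimate, uniformly bounded at distance at least \<open>r\<close> from the complement of \<open>U\<close>.  Hence it is
holomorphic itself, as a limit of a bounded sequence.\<close>

lemma cpartial_Hinf: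
  assumes U: "open U" and V: "open V" and r: "0 < r" "\<And>z. z \<in> V \<Longrightarrow> ball z r \<subseteq> U"
    and hol: "holomorphic_vec g U" and bound: "\<And>z. z \<in> U \<Longrightarrow> norm (g z) \<le> B"
  shows "holomorphic_vec (cpartial j g) V" and "z \<in> V \<Longrightarrow> norm (cpartial j g z) \<le> 2 * B / r"
proof -
  \<comment> \<open>Steps that tend to zero and are smaller than \<open>r / 2\<close>, as the fundamental estimate demands.\<close>
  define e :: "nat \<Rightarrow> complex" where "e n = of_real (r / (4 * real (Suc n)))" for n
  define Q where "Q n z = inverse (e n) * (g (z + axis j (e n)) + (-1) * g z)" for n z
  have norm_e: "norm (e n) = r / (4 * real (Suc n))" for n
    unfolding e_def using r(1) by (simp only: norm_of_real) simp
  have e: "e n \<noteq> 0" "norm (e n) < r / 2" for n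
  proof -
    have "norm (e n) \<le> r / 4"
      using r(1) unfolding norm_e by (simp add: field_simps)
    then show "norm (e n) < r / 2"
      using r(1) by simp
    have "norm (e n) > 0"
      using r(1) unfolding norm_e by simp
    then show "e n \<noteq> 0"
      by auto
  qed
  have "e \<longlonglongrightarrow> 0"
  proof (rule tendsto_norm_zero_cancel)
    have "(\<lambda>n. r / 4 * (1 / real (Suc n))) \<longlonglongrightarrow> r / 4 * 0"
      by (intro tendsto_mult tendsto_const LIMSEQ_Suc lim_1_over_n)
    then show "(\<lambda>n. norm (e n)) \<longlonglongrightarrow> 0"
      by (simp add: norm_e)
  qed
  then have e_lim: "filterlim e (at 0) sequentially"
    using e by (simp add: filterlim_at)
  have sub: "V \<subseteq> U"
    using r by force
  have mem: "z + axis j (e n) \<in> U" if "z \<in> V" for z n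
    using r(2)[OF that] e(2)[of n] r(1) by (auto simp: subset_iff dist_norm norm_axis_complex)
  have hQ: "holomorphic_vec (Q n) V" for n
    unfolding Q_def
    by (intro holomorphic_vec_cmult holomorphic_vec_add holomorphic_vec_shift[OF hol]
        holomorphic_vec_subset[OF hol sub] mem)
  have bQ: "norm (Q n z) \<le> 2 * B / r" if z: "z \<in> V" for n z
  proof -
    have "norm (g (z + axis j (e n)) - g z) \<le> 2 * B / r * norm (axis j (e n))"
      using e(2)[of n] r(2)[OF z] bound
      by (intro bounded_holomorphic_vec_estimates(2)[OF hol r(2)[OF z] r(1)]) (auto simp: norm_axis_complex)
    then show ?thesis
      using e(1)[of n] by (simp add: Q_def norm_mult norm_inverse norm_axis_complex norm_divide field_simps)
  qed
  have lQ: "(\<lambda>n. Q n z) \<longlonglongrightarrow> cpartial j g z" if z: "z \<in> V" for z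
  proof -
    have "((\<lambda>s. g (z + axis j s)) has_field_derivative cpartial j g z) (at 0)"
      using holomorphic_vec_line[OF hol, of z 0 "axis j 1"] z sub
      by (subst (1) axis_eq_scale) (auto simp: cpartial_eq_cD[OF hol])
    then have "((\<lambda>s. (g (z + axis j s) - g z) / s) \<longlongrightarrow> cpartial j g z) (at 0)"
      by (simp add: DERIV_def axis_eq_scale[of j 0])
    then have "(\<lambda>n. (g (z + axis j (e n)) - g z) / e n) \<longlonglongrightarrow> cpartial j g z"
      using e_lim by (rule filterlim_compose)
    then show ?thesis
      by (simp add: Q_def divide_inverse mult.commute)
  qed
  show "holomorphic_vec (cpartial j g) V"
    using bounded_pointwise_limit(1)[OF V hQ bQ lQ] .
  show "norm (cpartial j g z) \<le> 2 * B / r" if "z \<in> V"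
    using LIMSEQ_le_const2[OF tendsto_norm[OF lQ[OF that]]] bQ[OF that] by blast
qed


section \<open>Approximation of bp-continuous functionals by combinations of evaluations\<close>

lemma Hinf_zero: "(\<lambda>_. 0) \<in> Hinf U"
  by (rule HinfI[where B = 0]) (auto simp: holomorphic_vec_def intro!: exI[of _ "\<lambda>_. 0"])

lemma Hinf_linear_simps:
  assumes "Hinf_linear U \<phi>"
  shows Hinf_linear_add: "g \<in> Hinf U \<Longrightarrow> h \<in> Hinf U \<Longrightarrow> \<phi> (\<lambda>z. g z + h z) = \<phi> g + \<phi> h"
    and Hinf_linear_cmult: "g \<in> Hinf U \<Longrightarrow> \<phi> (\<lambda>z. c * g z) = c * \<phi> g"
    and Hinf_linear_zero: "\<phi> (\<lambda>_. 0) = 0"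
proof -
  show "g \<in> Hinf U \<Longrightarrow> h \<in> Hinf U \<Longrightarrow> \<phi> (\<lambda>z. g z + h z) = \<phi> g + \<phi> h"
    and scale: "g \<in> Hinf U \<Longrightarrow> \<phi> (\<lambda>z. c * g z) = c * \<phi> g" for g h c
    using assms by (auto simp: Hinf_linear_def)
  show "\<phi> (\<lambda>_. 0) = 0"
    using scale[OF Hinf_zero, of 0] by simp
qed

lemma bp_continuousD:
  assumes "bp_continuous U \<phi>" "\<And>n. g n \<in> Hinf U" "l \<in> Hinf U" "bp_converges U g l"
  shows "(\<lambda>n. \<phi> (g n)) \<longlonglongrightarrow> \<phi> l"
  using assms unfolding bp_continuous_def by blast

definition Hinf_unit_ball :: "(complex ^ 'd) set \<Rightarrow> (complex ^ 'd \<Rightarrow> complex) set" where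
  "Hinf_unit_ball U = {g \<in> Hinf U. \<forall>z\<in>U. norm (g z) \<le> 1}"

text \<open>If \<open>\<phi>\<close> were unbounded on the unit ball, there would be \<open>g\<^sub>n\<close> in it with \<open>\<bar>\<phi> (g\<^sub>n)\<bar> > n + 1\<close>; but
\<open>g\<^sub>n / (n + 1)\<close> tends to \<open>0\<close> uniformly, contradicting the continuity of \<open>\<phi>\<close>.\<close>

lemma bp_continuous_bounded:
  assumes lin: "Hinf_linear U \<phi>" and bp: "bp_continuous U \<phi>"
  obtains A where "0 \<le> A" "\<And>g. g \<in> Hinf_unit_ball U \<Longrightarrow> norm (\<phi> g) \<le> A"
proof -
  have "\<exists>A. \<forall>g\<in>Hinf_unit_ball U. norm (\<phi> g) \<le> A"
  proof (rule ccontr)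
    assume "\<not> ?thesis"
    then have "\<exists>g\<in>Hinf_unit_ball U. real (Suc n) < norm (\<phi> g)" for n
      by (meson not_le)
    then obtain g where g: "\<And>n. g n \<in> Hinf_unit_ball U" "\<And>n. real (Suc n) < norm (\<phi> (g n))"
      by metis
    define e :: "nat \<Rightarrow> complex" where "e n = of_real (1 / real (Suc n))" for n
    have norm_e: "norm (e n) = 1 / real (Suc n)" for n
      unfolding e_def norm_of_real by simp
    have mem: "g n \<in> Hinf U" for n
      using g(1) by (simp add: Hinf_unit_ball_def)
    have e_lim: "(\<lambda>n. norm (e n)) \<longlonglongrightarrow> 0"
      unfolding norm_e by (intro LIMSEQ_Suc lim_1_over_n)
    have le: "norm (e n * g n z) \<le> norm (e n)" if "z \<in> U" for n z
      using g(1)[of n] that by (auto simp: Hinf_unit_ball_def norm_mult intro: mult_left_le)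
    have "norm (e n) \<le> 1" for n
      unfolding norm_e by simp
    then have "\<forall>n. \<forall>z\<in>U. norm (e n * g n z) \<le> 1"
      using le order_trans by blast
    moreover have "(\<lambda>n. e n * g n z) \<longlonglongrightarrow> 0" if "z \<in> U" for z
      by (rule Lim_null_comparison[OF _ e_lim]) (use le[OF that] in auto)
    ultimately have "bp_converges U (\<lambda>n z. e n * g n z) (\<lambda>_. 0)"
      unfolding bp_converges_def by blast
    then have "(\<lambda>n. \<phi> (\<lambda>z. e n * g n z)) \<longlonglongrightarrow> 0"
      using bp_continuousD[OF bp, of "\<lambda>n z. e n * g n z", OF Hinf_cmult[OF mem] Hinf_zero]
      by (simp add: Hinf_linear_zero[OF lin])
    then have "\<forall>\<^sub>F n in sequentially. norm (e n * \<phi> (g n)) < 1"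
      using Hinf_linear_cmult[OF lin mem] by (auto simp: tendsto_iff)
    moreover have "1 < norm (e n * \<phi> (g n))" for n
      using g(2)[of n] by (simp add: norm_mult norm_e field_simps)
    ultimately show False
      using not_less_iff_gr_or_eq by (auto simp: eventually_sequentially)
  qed
  then obtain A where "\<forall>g\<in>Hinf_unit_ball U. norm (\<phi> g) \<le> A"
    by blast
  then show ?thesis
    using that[of "max A 0"] by (auto simp: le_max_iff_disj)
qed

lemma Hinf_norm_bound_scale:
  assumes lin: "Hinf_linear U \<phi>" and A: "\<And>g. g \<in> Hinf_unit_ball U \<Longrightarrow> norm (\<phi> g) \<le> A"
    and g: "g \<in> Hinf U" "\<And>z. z \<in> U \<Longrightarrow> norm (g z) \<le> B" and B: "0 \<le> B"
  shows "norm (\<phi> g) \<le> A * B"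
proof -
  \<comment> \<open>Scaling by a positive \<open>C\<close> slightly larger than \<open>B\<close> covers the case \<open>B = 0\<close>.\<close>
  have main: "norm (\<phi> g) \<le> A * C" if C: "B \<le> C" "0 < C" for C
  proof -
    have "(\<lambda>z. inverse (of_real C) * g z) \<in> Hinf_unit_ball U"
      using Hinf_cmult[OF g(1), of "inverse (of_real C)"] order_trans[OF g(2) C(1)] C(2)
      by (simp add: Hinf_unit_ball_def norm_mult norm_inverse norm_divide field_simps)
    then have "norm (inverse (of_real C) * \<phi> g) \<le> A"
      using A Hinf_linear_cmult[OF lin g(1)] by metis
    then show ?thesis
      using C by (simp add: norm_mult norm_inverse norm_divide field_simps)
  qed
  show ?thesis
  proof (rule tendsto_lowerbound)
    show "((\<lambda>C. A * C) \<longlongrightarrow> A * B) (at_right B)"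
      by (intro tendsto_intros)
    show "\<forall>\<^sub>F C in at_right B. norm (\<phi> g) \<le> A * C"
      using main B by (auto simp: eventually_at_filter)
  qed simp
qed

text \<open>The unit ball is locally equicontinuous by the fundamental estimate, so convergence on a dense set
implies pointwise convergence.\<close>

lemma tendsto_zero_of_dense:
  fixes U :: "(complex ^ 'd) set"
  assumes U: "open U" and g: "\<And>n. g n \<in> Hinf_unit_ball U"
    and dense: "\<And>z \<delta>. z \<in> U \<Longrightarrow> 0 < \<delta> \<Longrightarrow> \<exists>k. dist (x k) z < \<delta>"
    and lim: "\<And>k. (\<lambda>n. g n (x k)) \<longlonglongrightarrow> 0" and z: "z \<in> U"
  shows "(\<lambda>n. g n z) \<longlonglongrightarrow> 0"
proof (rule tendstoI)
  fix \<epsilon> :: real assume \<epsilon>: "0 < \<epsilon>"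
  obtain r where r: "0 < r" "ball z r \<subseteq> U"
    using U z open_contains_ball by blast
  obtain k where k: "dist (x k) z < min (r / 2) (\<epsilon> * r / 4)"
    using dense[OF z, of "min (r / 2) (\<epsilon> * r / 4)"] r(1) \<epsilon> by auto
  have near: "norm (g n z) \<le> norm (g n (x k)) + \<epsilon> / 2" for n
  proof -
    have "norm (g n (z + (x k - z)) - g n z) \<le> 2 * 1 / r * norm (x k - z)"
      using g[of n] r(2) k
      by (intro bounded_holomorphic_vec_estimates(2)[of "g n" U z r 1 "x k - z", OF _ r(2,1)])
        (auto simp: Hinf_unit_ball_def Hinf_def dist_norm)
    also have "\<dots> \<le> \<epsilon> / 2"
      using k r(1) by (simp add: dist_norm field_simps)
    finally show ?thesis
      using norm_triangle_ineq3[of "g n z" "g n (x k)"] norm_minus_commute[of "g n z"] by simp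
  qed
  have "\<forall>\<^sub>F n in sequentially. norm (g n (x k)) < \<epsilon> / 2"
    using tendstoD[OF lim[of k], of "\<epsilon> / 2"] \<epsilon> by simp
  then show "\<forall>\<^sub>F n in sequentially. dist (g n z) 0 < \<epsilon>"
  proof eventually_elim
    case (elim n)
    then show ?case using near[of n] by simp
  qed
qed

lemma norm_add_scaled_squared:
  fixes a d :: complex
  shows "(norm (a + of_real s * d))\<^sup>2 = (norm a)\<^sup>2 + 2 * s * Re (cnj a * d) + s\<^sup>2 * (norm d)\<^sup>2"
  unfolding cmod_power2 by (simp add: power2_eq_square algebra_simps)

text \<open>This is where the approximating combination of point evaluations is found.  Consider the concave
functional \<open>J g = Re (\<phi> g) - N (\<Sum>k<N. \<bar>g (x k)\<bar>\<^sup>2)\<close> on the unit ball.  At a maximiser \<open>g\<close> the first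
variation in the direction \<open>h - g\<close> is nonpositive, that is \<open>Re (\<phi> - \<psi>) (h - g) \<le> 0\<close> for the gradient
\<open>\<psi> h = \<Sum>k<N. c k * h (x k)\<close> of the penalty, where \<open>c k = 2 N cnj (g (x k))\<close>.  Since \<open>Re (\<psi> g) \<ge> 0\<close>,
the value of \<open>Re (\<phi> - \<psi>)\<close> is at most \<open>\<bar>\<phi> g\<bar>\<close> on the whole ball.  On the other hand \<open>J 0 = 0\<close> shows
that the penalty at \<open>g\<close> is bounded, so that \<open>g\<close> is small at the points \<open>x k\<close> when \<open>N\<close> is large.

Existence of a maximiser would need the compactness of the unit ball.  It is enough to have \<open>g\<close> with
\<open>J g\<close> within \<open>s\<^sup>2\<close> of the supremum and to move a distance \<open>s\<close> towards \<open>h\<close>.\<close>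

lemma near_maximiser:
  fixes U :: "(complex ^ 'd) set" and N :: nat
  assumes lin: "Hinf_linear U \<phi>" and A: "\<And>g. g \<in> Hinf_unit_ball U \<Longrightarrow> norm (\<phi> g) \<le> A"
    and x: "\<And>k. x k \<in> U"
  obtains g c where "g \<in> Hinf_unit_ball U"
    and "real N * (\<Sum>k<N. (norm (g (x k)))\<^sup>2) \<le> A + 1"
    and "\<And>h. h \<in> Hinf_unit_ball U \<Longrightarrow>
      Re (\<phi> h - (\<Sum>k<N. c k * h (x k))) \<le> norm (\<phi> g) + 5 / real (Suc N)"
proof -
  define P :: "(complex ^ 'd \<Rightarrow> complex) \<Rightarrow> real" where "P g = (\<Sum>k<N. (norm (g (x k)))\<^sup>2)" for g
  define J where "J g = Re (\<phi> g) - real N * P g" for g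
  \<comment> \<open>The first variation is then at most \<open>s + 4 s N\<^sup>2\<close>: the first term comes from the defect \<open>s\<^sup>2\<close>, the
    second from the quadratic part of the penalty, as \<open>\<bar>d\<bar> \<le> 2\<close> for the direction \<open>d\<close>.  The cube in \<open>s\<close>
    makes this \<open>O(1 / N)\<close>.\<close>
  define s where "s = 1 / real (Suc N) ^ 3"
  have P: "0 \<le> P g" for g
    by (auto simp: P_def intro: sum_nonneg)
  have s: "0 < s" "s \<le> 1"
    by (auto simp: s_def field_simps intro: one_le_power[of "1 + real N" 3])
  have J_le: "J g \<le> A" if "g \<in> Hinf_unit_ball U" for g
  proof -
    have "J g \<le> Re (\<phi> g)"
      using P[of g] by (simp add: J_def)
    also have "\<dots> \<le> A"
      using A[OF that] complex_Re_le_cmod order_trans by blast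
    finally show ?thesis .
  qed
  then have bdd: "bdd_above (J ` Hinf_unit_ball U)"
    by (auto intro!: bdd_aboveI)
  have zero: "(\<lambda>_. 0) \<in> Hinf_unit_ball U"
    by (simp add: Hinf_unit_ball_def Hinf_zero)
  have "\<exists>y\<in>J ` Hinf_unit_ball U. Sup (J ` Hinf_unit_ball U) - s\<^sup>2 < y"
    using zero s by (intro less_cSupD) auto
  then obtain g where g: "g \<in> Hinf_unit_ball U" "Sup (J ` Hinf_unit_ball U) - s\<^sup>2 < J g"
    by blast
  have max: "J h \<le> J g + s\<^sup>2" if "h \<in> Hinf_unit_ball U" for h
    using cSup_upper[OF imageI[of h _ J] bdd] that g(2) by fastforce
  define c where "c k = of_real (2 * real N) * cnj (g (x k))" for k
  show ?thesis
  proof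
    show "g \<in> Hinf_unit_ball U" by (rule g(1))
    have "0 \<le> J g + s\<^sup>2"
      using max[OF zero] by (simp add: J_def P_def Hinf_linear_zero[OF lin])
    moreover have "Re (\<phi> g) \<le> A"
      using A[OF g(1)] complex_Re_le_cmod order_trans by blast
    moreover have "s\<^sup>2 \<le> 1"
      using s by (simp add: power_le_one)
    ultimately show "real N * (\<Sum>k<N. (norm (g (x k)))\<^sup>2) \<le> A + 1"
      by (simp add: J_def P_def)
  next
    fix h assume h: "h \<in> Hinf_unit_ball U"
    define d where "d z = h z + (-1) * g z" for z
    have gH: "g \<in> Hinf U" "h \<in> Hinf U"
      using g(1) h by (auto simp: Hinf_unit_ball_def)
    then have dH: "d \<in> Hinf U"
      unfolding d_def by (intro Hinf_add Hinf_cmult)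
    have \<phi>d: "\<phi> d = \<phi> h - \<phi> g"
      unfolding d_def using gH Hinf_linear_add[OF lin gH(2) Hinf_cmult[OF gH(1)], of "-1"]
        Hinf_linear_cmult[OF lin gH(1), of "-1"] by simp
    define w where "w z = g z + of_real s * d z" for z
    have wH: "w \<in> Hinf U"
      unfolding w_def by (intro Hinf_add Hinf_cmult gH dH)
    have "norm (w z) \<le> 1" if "z \<in> U" for z
    proof -
      have "w z = of_real (1 - s) * g z + of_real s * h z"
        by (simp add: w_def d_def algebra_simps)
      also have "norm \<dots> \<le> (1 - s) * norm (g z) + s * norm (h z)"
        using s by (intro order_trans[OF norm_triangle_ineq]) (simp add: norm_mult del: of_real_diff)
      also have "\<dots> \<le> (1 - s) * 1 + s * 1"
        using s g(1) h that by (intro add_mono mult_left_mono) (auto simp: Hinf_unit_ball_def)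
      finally show ?thesis by simp
    qed
    then have "w \<in> Hinf_unit_ball U"
      using wH by (simp add: Hinf_unit_ball_def)
    then have Jw: "J w \<le> J g + s\<^sup>2"
      by (rule max)
    define Q where "Q = (\<Sum>k<N. Re (cnj (g (x k)) * d (x k)))"
    have \<phi>w: "\<phi> w = \<phi> g + of_real s * \<phi> d"
      unfolding w_def using Hinf_linear_add[OF lin gH(1) Hinf_cmult[OF dH]] Hinf_linear_cmult[OF lin dH]
      by simp
    have Pw: "P w = P g + 2 * s * Q + s\<^sup>2 * P d"
      unfolding P_def Q_def w_def norm_add_scaled_squared
      by (simp only: sum.distrib sum_distrib_left)
    have Pd: "P d \<le> 4 * real N"
    proof -
      have "(norm (d z))\<^sup>2 \<le> 2\<^sup>2" if "z \<in> U" for z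
      proof (rule power_mono)
        have "norm (g z) \<le> 1" "norm (h z) \<le> 1"
          using g(1) h that by (auto simp: Hinf_unit_ball_def)
        then show "norm (d z) \<le> 2"
          using norm_triangle_ineq4[of "h z" "g z"] by (simp add: d_def)
      qed simp
      then have "P d \<le> (\<Sum>k<N. 4)"
        unfolding P_def by (intro sum_mono) (use x in auto)
      then show ?thesis by simp
    qed
    have "s * (Re (\<phi> d) - 2 * real N * Q) \<le> s\<^sup>2 + s\<^sup>2 * (real N * P d)"
      using Jw by (simp add: J_def \<phi>w Pw algebra_simps)
    also have "\<dots> \<le> s\<^sup>2 + s\<^sup>2 * (real N * (4 * real N))"
      by (intro add_left_mono mult_left_mono Pd) auto
    also have "\<dots> = s * (s * (1 + 4 * (real N)\<^sup>2))"
      by (simp add: power2_eq_square algebra_simps)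
    finally have "Re (\<phi> d) - 2 * real N * Q \<le> s * (1 + 4 * (real N)\<^sup>2)"
      using s(1) by (rule mult_left_le_imp_le)
    also have "\<dots> \<le> s * (5 * (real (Suc N))\<^sup>2)"
      using s(1) by (intro mult_left_mono) (auto simp: power2_eq_square algebra_simps)
    also have "\<dots> = 5 / real (Suc N)"
      unfolding s_def power2_eq_square power3_eq_cube by (simp add: divide_simps)
    finally have X: "Re (\<phi> d) - 2 * real N * Q \<le> 5 / real (Suc N)" .
    have "Re (\<Sum>k<N. c k * h (x k)) = 2 * real N * Q + 2 * real N * P g"
    proof -
      have "Re (c k * h (x k)) = 2 * real N * Re (cnj (g (x k)) * d (x k)) + 2 * real N * (norm (g (x k)))\<^sup>2" for k
        unfolding cmod_power2 by (simp add: c_def d_def power2_eq_square algebra_simps)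
      then show ?thesis
        by (simp only: Q_def P_def Re_sum sum.distrib sum_distrib_left)
    qed
    moreover have "Re (\<phi> g) \<le> norm (\<phi> g)"
      by (rule complex_Re_le_cmod)
    moreover have "0 \<le> 2 * real N * P g"
      using P by simp
    ultimately show "Re (\<phi> h - (\<Sum>k<N. c k * h (x k))) \<le> norm (\<phi> g) + 5 / real (Suc N)"
      using X unfolding \<phi>d by simp
  qed
qed

lemma dense_sequence:
  fixes U :: "'e::euclidean_space set"
  assumes "U \<noteq> {}"
  obtains x :: "nat \<Rightarrow> 'e" where "\<And>k. x k \<in> U" "\<And>z \<delta>. z \<in> U \<Longrightarrow> 0 < \<delta> \<Longrightarrow> \<exists>k. dist (x k) z < \<delta>"
proof -
  obtain T where T: "countable T" "T \<subseteq> U" "U \<subseteq> closure T"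
    using separable by blast
  then have "T \<noteq> {}"
    using assms by auto
  show ?thesis
  proof (rule that[of "from_nat_into T"])
    show "from_nat_into T k \<in> U" for k
      using from_nat_into[OF \<open>T \<noteq> {}\<close>] T(2) by blast
    fix z and \<delta> :: real assume "z \<in> U" "0 < \<delta>"
    then obtain y where "y \<in> T" "dist y z < \<delta>"
      using T(3) closure_approachable by blast
    then show "\<exists>k. dist (from_nat_into T k) z < \<delta>"
      using from_nat_into_surj[OF T(1)] by metis
  qed
qed

text \<open>The near-maximisers \<open>g\<^sub>N\<close> of the preceding lemma, for a sequence \<open>x\<close> that is dense in \<open>U\<close>, tend to zero at
each \<open>x k\<close>, hence pointwise on \<open>U\<close> and boundedly.  By continuity \<open>\<phi> (g\<^sub>N) \<longlonglongrightarrow> 0\<close>, and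
this bounds the distance from \<open>\<phi>\<close> to the corresponding combinations of evaluations.\<close>

lemma bp_continuous_approximation:
  fixes U :: "(complex ^ 'd) set"
  assumes U: "open U" "U \<noteq> {}" and lin: "Hinf_linear U \<phi>" and bp: "bp_continuous U \<phi>"
    and \<epsilon>: "0 < \<epsilon>"
  obtains N :: nat and c x where "\<And>k. x k \<in> U"
    and "\<And>h. h \<in> Hinf_unit_ball U \<Longrightarrow> norm (\<phi> h - (\<Sum>k<N. c k * h (x k))) \<le> \<epsilon>"
proof -
  obtain x :: "nat \<Rightarrow> complex ^ 'd" where x: "\<And>k. x k \<in> U"
    and dense: "\<And>z \<delta>. z \<in> U \<Longrightarrow> 0 < \<delta> \<Longrightarrow> \<exists>k. dist (x k) z < \<delta>"
    using dense_sequence[OF U(2)] by metis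
  obtain A where A: "0 \<le> A" "\<And>g. g \<in> Hinf_unit_ball U \<Longrightarrow> norm (\<phi> g) \<le> A"
    using bp_continuous_bounded[OF lin bp] by metis
  define good where "good N g c \<longleftrightarrow> g \<in> Hinf_unit_ball U \<and>
      real N * (\<Sum>k<N. (norm (g (x k)))\<^sup>2) \<le> A + 1 \<and>
      (\<forall>h\<in>Hinf_unit_ball U. Re (\<phi> h - (\<Sum>k<N. c k * h (x k))) \<le> norm (\<phi> g) + 5 / real (Suc N))"
    for N g c
  have "\<exists>gc. good N (fst gc) (snd gc)" for N
  proof (rule near_maximiser[OF lin A(2), where x = x and N = N])
    fix g c assume "g \<in> Hinf_unit_ball U" "real N * (\<Sum>k<N. (norm (g (x k)))\<^sup>2) \<le> A + 1"
      "\<And>h. h \<in> Hinf_unit_ball U \<Longrightarrow>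
        Re (\<phi> h - (\<Sum>k<N. c k * h (x k))) \<le> norm (\<phi> g) + 5 / real (Suc N)"
    then show ?thesis
      by (intro exI[of _ "(g, c)"]) (simp add: good_def)
  qed (use x in auto)
  then have "\<exists>gc. \<forall>N. good N (fst (gc N)) (snd (gc N))"
    by (intro choice) simp
  then obtain gc where gc: "\<And>N. good N (fst (gc N)) (snd (gc N))"
    by blast
  define g c where "g N = fst (gc N)" and "c N = snd (gc N)" for N
  have good: "\<And>N. good N (g N) (c N)"
    using gc by (simp add: g_def c_def)
  then have g: "\<And>N. g N \<in> Hinf_unit_ball U"
    and gN: "\<And>N. real N * (\<Sum>k<N. (norm (g N (x k)))\<^sup>2) \<le> A + 1"
    and c: "\<And>N h. h \<in> Hinf_unit_ball U \<Longrightarrow>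
      Re (\<phi> h - (\<Sum>k<N. c N k * h (x k))) \<le> norm (\<phi> (g N)) + 5 / real (Suc N)"
    unfolding good_def by blast+
  have "(\<lambda>N. g N (x k)) \<longlonglongrightarrow> 0" for k
  proof -
    have "(\<lambda>N. (norm (g N (x k)))\<^sup>2) \<longlonglongrightarrow> 0"
    proof (rule Lim_null_comparison)
      show "\<forall>\<^sub>F N in sequentially. norm ((norm (g N (x k)))\<^sup>2) \<le> (A + 1) * (1 / real N)"
        using eventually_gt_at_top[of k]
      proof eventually_elim
        case (elim N)
        have "real N * (norm (g N (x k)))\<^sup>2 \<le> real N * (\<Sum>k<N. (norm (g N (x k)))\<^sup>2)"
          using elim by (intro mult_left_mono member_le_sum) auto
        also have "\<dots> \<le> A + 1"
          by (rule gN)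
        finally show ?case
          using elim by (simp add: pos_le_divide_eq mult.commute)
      qed
      show "(\<lambda>N. (A + 1) * (1 / real N)) \<longlonglongrightarrow> 0"
        using tendsto_mult_left[OF lim_1_over_n, of "A + 1"] by simp
    qed
    then show ?thesis
      using tendsto_real_sqrt tendsto_norm_zero_iff by fastforce
  qed
  note lim_dense = this
  have "(\<lambda>N. g N z) \<longlonglongrightarrow> 0" if "z \<in> U" for z
    by (rule tendsto_zero_of_dense[where g = g and x = x, OF U(1) g dense lim_dense that])
  then have "bp_converges U g (\<lambda>_. 0)"
    using g by (auto simp: bp_converges_def Hinf_unit_ball_def intro!: exI[of _ 1])
  then have "(\<lambda>N. \<phi> (g N)) \<longlonglongrightarrow> 0"
    using bp_continuousD[OF bp, of g, OF _ Hinf_zero] g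
    by (simp add: Hinf_linear_zero[OF lin] Hinf_unit_ball_def)
  then have "(\<lambda>N. norm (\<phi> (g N)) + 5 * (1 / real (Suc N))) \<longlonglongrightarrow> 0 + 5 * 0"
    by (intro tendsto_add tendsto_mult tendsto_const LIMSEQ_Suc[OF lim_1_over_n] tendsto_norm_zero)
  then have "\<forall>\<^sub>F N in sequentially. norm (\<phi> (g N)) + 5 * (1 / real (Suc N)) < \<epsilon>"
    using \<epsilon> by (intro order_tendstoD(2)[where y = 0]) simp_all
  then obtain N where N: "norm (\<phi> (g N)) + 5 / real (Suc N) < \<epsilon>"
    by (auto simp: eventually_sequentially)
  show ?thesis
  proof (rule that[of x "c N" N])
    show "x k \<in> U" for k by (rule x)
  next
    fix h assume h: "h \<in> Hinf_unit_ball U"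
    define y where "y = \<phi> h - (\<Sum>k<N. c N k * h (x k))"
    show "norm (\<phi> h - (\<Sum>k<N. c N k * h (x k))) \<le> \<epsilon>"
    proof (cases "y = 0")
      case True
      then show ?thesis using \<epsilon> by (simp add: y_def)
    next
      case False
      \<comment> \<open>The bound on real parts for the rotated function \<open>u h\<close> is a bound on the modulus for \<open>h\<close>.\<close>
      define u where "u = cnj y / of_real (norm y)"
      have nu: "norm u = 1"
        using False by (simp add: u_def norm_divide)
      have "u * y = of_real (norm y)"
        using False by (simp add: u_def complex_norm_square[symmetric] mult.commute[of "cnj y"] power2_eq_square)
      have hH: "h \<in> Hinf U"
        using h by (simp add: Hinf_unit_ball_def)
      have "(\<lambda>z. u * h z) \<in> Hinf_unit_ball U"
        using h nu Hinf_cmult[OF hH, of u] by (auto simp: Hinf_unit_ball_def norm_mult)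
      then have "Re (\<phi> (\<lambda>z. u * h z) - (\<Sum>k<N. c N k * (u * h (x k)))) \<le> \<epsilon>"
        using c[of "\<lambda>z. u * h z" N] N by linarith
      moreover have "\<phi> (\<lambda>z. u * h z) - (\<Sum>k<N. c N k * (u * h (x k))) = u * y"
        by (simp add: y_def Hinf_linear_cmult[OF lin hH] right_diff_distrib sum_distrib_left mult.left_commute)
      ultimately have "Re (u * y) \<le> \<epsilon>"
        by (simp only:)
      then show ?thesis
        unfolding \<open>u * y = _\<close> y_def[symmetric] by simp
    qed
  qed
qed


section \<open>Seminorms and duality\<close>

lemma Lp_seminorm_nonneg [simp]: "0 \<le> Lp_seminorm M p u"
  by (simp add: Lp_seminorm_def)

lemma Lp_seminorm_powr:
  assumes "0 < p"
  shows "Lp_seminorm M p u powr p = (\<integral>t. norm (u t) powr p \<partial>M)"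
  using assms by (simp add: Lp_seminorm_def powr_powr)

lemma Lp_seminorm_le_iff:
  assumes "0 < p" "0 \<le> C"
  shows "Lp_seminorm M p u \<le> C \<longleftrightarrow> (\<integral>t. norm (u t) powr p \<partial>M) \<le> C powr p"
  using assms Lp_seminorm_powr[of p M u] powr_mono2[of p] powr_less_mono2[of p C "Lp_seminorm M p u"]
  by (metis Lp_seminorm_nonneg less_imp_le not_le)

lemma Lp_seminorm_scale:
  assumes "0 < p"
  shows "Lp_seminorm M p (\<lambda>t. c * u t) = norm c * Lp_seminorm M p u"
  using assms by (simp add: Lp_seminorm_def norm_mult powr_mult powr_powr)

lemma Lp_seminorm_cong:
  assumes "\<And>t. t \<in> space M \<Longrightarrow> u t = v t"
  shows "Lp_seminorm M p u = Lp_seminorm M p v"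
  unfolding Lp_seminorm_def using assms
  by (intro arg_cong2[where f = "(powr)"] Bochner_Integration.integral_cong) auto

lemma Lp_fun_cong:
  assumes "\<And>t. t \<in> space M \<Longrightarrow> u t = v t"
  shows "u \<in> Lp_fun M p \<longleftrightarrow> v \<in> Lp_fun M p"
  unfolding Lp_fun_def using assms measurable_cong[of M u v borel]
    Bochner_Integration.integrable_cong[of M M "\<lambda>t. norm (u t) powr p" "\<lambda>t. norm (v t) powr p"] by auto

lemma Lp_fun_diff:
  assumes "0 < p" "u \<in> Lp_fun M p" "v \<in> Lp_fun M p"
  shows "(\<lambda>t. u t - v t) \<in> Lp_fun M p"
  using Lp_fun_add[OF assms(1,2) Lp_fun_scale[OF assms(3), of "-1"]] by simp

lemma Lp_fun_sum:
  fixes N :: nat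
  assumes "0 < p" "\<And>k. k < N \<Longrightarrow> u k \<in> Lp_fun M p"
  shows "(\<lambda>t. \<Sum>k<N. c k * u k t) \<in> Lp_fun M p"
  using assms(2)
proof (induct N)
  case 0
  then show ?case by (simp add: Lp_fun_def)
next
  case (Suc N)
  from Suc.prems show ?case
    using Lp_fun_add[OF assms(1) Suc.hyps Lp_fun_scale[of "u N" M p "c N"]] by simp
qed

lemma
  assumes p: "0 < p" and v: "v \<in> borel_measurable M" and u: "u \<in> Lp_fun M p"
    and le: "\<And>t. t \<in> space M \<Longrightarrow> norm (v t) \<le> norm (u t)"
  shows Lp_fun_dominated: "v \<in> Lp_fun M p"
    and Lp_seminorm_dominated: "Lp_seminorm M p v \<le> Lp_seminorm M p u"
proof -
  have [measurable]: "u \<in> borel_measurable M" "v \<in> borel_measurable M"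
    and int_u: "integrable M (\<lambda>t. norm (u t) powr p)"
    using u v by (auto simp: Lp_fun_def)
  have le': "norm (v t) powr p \<le> norm (u t) powr p" if "t \<in> space M" for t
    using le[OF that] p by (intro powr_mono2) auto
  have int_v: "integrable M (\<lambda>t. norm (v t) powr p)"
    by (rule Bochner_Integration.integrable_bound[OF int_u]) (use le' in auto)
  then show "v \<in> Lp_fun M p"
    by (simp add: Lp_fun_def)
  show "Lp_seminorm M p v \<le> Lp_seminorm M p u"
    unfolding Lp_seminorm_def using p
    by (intro powr_mono2 integral_mono int_u int_v le' integral_nonneg) auto
qed

lemma Lp_Fatou:
  assumes p: "0 < p" and v: "\<And>m. v m \<in> Lp_fun M p" and C: "\<And>m. Lp_seminorm M p (v m) \<le> C"
    and lim: "\<And>t. t \<in> space M \<Longrightarrow> (\<lambda>m. v m t) \<longlonglongrightarrow> w t"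
  shows "w \<in> Lp_fun M p" and "Lp_seminorm M p w \<le> C"
proof -
  have v_meas [measurable]: "v m \<in> borel_measurable M" and int_v: "integrable M (\<lambda>t. norm (v m t) powr p)" for m
    using v[of m] by (auto simp: Lp_fun_def)
  have C0: "0 \<le> C"
    using C[of 0] Lp_seminorm_nonneg order_trans by blast
  have w_meas [measurable]: "w \<in> borel_measurable M"
    using lim v_meas by (rule borel_measurable_LIMSEQ_metric[rotated])
  have lim_powr: "(\<lambda>m. norm (v m t) powr p) \<longlonglongrightarrow> norm (w t) powr p" if "t \<in> space M" for t
    using p by (intro tendsto_powr' tendsto_norm lim that tendsto_const) auto
  have "(\<integral>\<^sup>+t. ennreal (norm (w t) powr p) \<partial>M) = (\<integral>\<^sup>+t. liminf (\<lambda>m. ennreal (norm (v m t) powr p)) \<partial>M)"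
    by (intro nn_integral_cong lim_imp_Liminf[symmetric] tendsto_ennrealI lim_powr) auto
  also have "\<dots> \<le> liminf (\<lambda>m. \<integral>\<^sup>+t. ennreal (norm (v m t) powr p) \<partial>M)"
    by (intro nn_integral_liminf) measurable
  also have "\<dots> \<le> ennreal (C powr p)"
  proof (rule order_trans[OF Liminf_le_Limsup Limsup_bounded])
    have "(\<integral>\<^sup>+t. ennreal (norm (v m t) powr p) \<partial>M) \<le> ennreal (C powr p)" for m
      using iffD1[OF Lp_seminorm_le_iff[OF p C0] C[of m]] by (simp add: nn_integral_eq_integral[OF int_v] ennreal_leI)
    then show "\<forall>\<^sub>F m in sequentially. (\<integral>\<^sup>+t. ennreal (norm (v m t) powr p) \<partial>M) \<le> ennreal (C powr p)"
      by simp
  qed simp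
  finally have fin: "(\<integral>\<^sup>+t. ennreal (norm (w t) powr p) \<partial>M) \<le> ennreal (C powr p)" .
  have int_w: "integrable M (\<lambda>t. norm (w t) powr p)"
  proof (rule integrableI_bounded)
    show "(\<integral>\<^sup>+t. ennreal (norm (norm (w t) powr p)) \<partial>M) < \<infinity>"
      using le_less_trans[OF fin ennreal_less_top] by simp
  qed measurable
  then show "w \<in> Lp_fun M p"
    by (simp add: Lp_fun_def)
  show "Lp_seminorm M p w \<le> C"
    using fin by (simp add: nn_integral_eq_integral[OF int_w] Lp_seminorm_le_iff[OF p C0])
qed

text \<open>Elements of \<open>L\<^sub>q\<close> enter the argument only as bounded functionals on \<open>L\<^sub>p\<close>.  Recording a bound \<open>N\<close> for the
norm of the functional treats finite and infinite \<open>q\<close> alike.\<close>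

definition dual_fun :: "'a measure \<Rightarrow> real \<Rightarrow> real \<Rightarrow> ('a \<Rightarrow> complex) \<Rightarrow> bool" where
  "dual_fun M p N h \<longleftrightarrow> h \<in> borel_measurable M \<and> 0 \<le> N \<and>
     (\<forall>w\<in>Lp_fun M p. integrable M (\<lambda>t. w t * h t) \<and>
        norm (\<integral>t. w t * h t \<partial>M) \<le> N * Lp_seminorm M p w)"

lemma dual_funD:
  assumes "dual_fun M p N h"
  shows "h \<in> borel_measurable M" "0 \<le> N"
    "w \<in> Lp_fun M p \<Longrightarrow> integrable M (\<lambda>t. w t * h t)"
    "w \<in> Lp_fun M p \<Longrightarrow> norm (\<integral>t. w t * h t \<partial>M) \<le> N * Lp_seminorm M p w"
  using assms by (auto simp: dual_fun_def)

text \<open>A pointwise inequality of the type of Young's bounds the pairing by \<open>A + (\<integral>t. G t \<partial>M)\<close> on the unit ball of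
\<open>L\<^sub>p\<close>; homogeneity does the rest.  For \<open>A = 1 / p\<close> and a function \<open>G\<close> with integral \<open>1 - 1 / p\<close> the bound is \<open>1\<close>,
as happens for the norming function below.\<close>

lemma dual_funI_Young:
  assumes p: "0 < p" and h [measurable]: "h \<in> borel_measurable M" and A: "0 \<le> A"
    and G: "integrable M G" "\<And>t. 0 \<le> G t"
    and young: "\<And>w. w \<in> Lp_fun M p \<Longrightarrow> AE t in M. norm (w t) * norm (h t) \<le> A * norm (w t) powr p + G t"
  shows "dual_fun M p (A + (\<integral>t. G t \<partial>M)) h"
proof -
  define N where "N = A + (\<integral>t. G t \<partial>M)"
  have N: "0 \<le> N"
    using A G by (auto simp: N_def intro!: add_nonneg_nonneg integral_nonneg)
  have int: "integrable M (\<lambda>t. w t * h t)"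
    and bound: "norm (\<integral>t. w t * h t \<partial>M) \<le> A * (\<integral>t. norm (w t) powr p \<partial>M) + (\<integral>t. G t \<partial>M)"
    if w: "w \<in> Lp_fun M p" for w
  proof -
    have [measurable]: "w \<in> borel_measurable M" and int_w: "integrable M (\<lambda>t. norm (w t) powr p)"
      using w by (auto simp: Lp_fun_def)
    have int_rhs: "integrable M (\<lambda>t. A * norm (w t) powr p + G t)"
      using int_w G(1) by simp
    show int: "integrable M (\<lambda>t. w t * h t)"
    proof (rule Bochner_Integration.integrable_bound[OF int_rhs])
      show "AE t in M. norm (w t * h t) \<le> norm (A * norm (w t) powr p + G t)"
        using young[OF w]
      proof eventually_elim
        case (elim t)
        then show ?case
          using A G(2)[of t] by (simp add: norm_mult)
      qed
    qed measurable
    have "norm (\<integral>t. w t * h t \<partial>M) \<le> (\<integral>t. norm (w t * h t) \<partial>M)"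
      by (rule integral_norm_bound)
    also have "\<dots> \<le> (\<integral>t. A * norm (w t) powr p + G t \<partial>M)"
      using young[OF w] by (intro integral_mono_AE integrable_norm int int_rhs) (simp add: norm_mult)
    also have "\<dots> = A * (\<integral>t. norm (w t) powr p \<partial>M) + (\<integral>t. G t \<partial>M)"
      using int_w G(1) by simp
    finally show "norm (\<integral>t. w t * h t \<partial>M) \<le> A * (\<integral>t. norm (w t) powr p \<partial>M) + (\<integral>t. G t \<partial>M)" .
  qed
  have "norm (\<integral>t. w t * h t \<partial>M) \<le> N * Lp_seminorm M p w" if w: "w \<in> Lp_fun M p" for w
  proof -
    \<comment> \<open>Scaling by \<open>C\<close> larger than the seminorm covers the case of a vanishing seminorm.\<close>
    have main: "norm (\<integral>t. w t * h t \<partial>M) \<le> N * C" if C: "Lp_seminorm M p w \<le> C" "0 < C" for C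
    proof -
      define v where "v t = inverse (of_real C) * w t" for t
      have v: "v \<in> Lp_fun M p"
        unfolding v_def by (rule Lp_fun_scale[OF w])
      have "Lp_seminorm M p v \<le> 1"
        using C unfolding v_def Lp_seminorm_scale[OF p] by (simp add: norm_inverse norm_divide field_simps)
      then have "(\<integral>t. norm (v t) powr p \<partial>M) \<le> 1"
        using Lp_seminorm_le_iff[OF p, of 1 M v] by simp
      then have "norm (\<integral>t. v t * h t \<partial>M) \<le> N"
        using bound[OF v] mult_left_le[OF _ A] unfolding N_def by (meson add_right_mono order_trans)
      moreover have "(\<integral>t. v t * h t \<partial>M) = inverse (of_real C) * (\<integral>t. w t * h t \<partial>M)"
        by (simp add: v_def mult.assoc)
      ultimately show ?thesis
        using C(2) by (simp add: norm_mult norm_inverse norm_divide divide_le_eq flip: divide_inverse_commute)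
    qed
    show ?thesis
    proof (rule tendsto_lowerbound)
      show "((\<lambda>C. N * C) \<longlongrightarrow> N * Lp_seminorm M p w) (at_right (Lp_seminorm M p w))"
        by (intro tendsto_intros)
      have "norm (\<integral>t. w t * h t \<partial>M) \<le> N * C" if "Lp_seminorm M p w < C" for C
        using main[of C] that le_less_trans[OF Lp_seminorm_nonneg that] by simp
      then show "\<forall>\<^sub>F C in at_right (Lp_seminorm M p w). norm (\<integral>t. w t * h t \<partial>M) \<le> N * C"
        by (auto simp: eventually_at_filter)
    qed simp
  qed
  then show ?thesis
    using int N h unfolding dual_fun_def N_def by blast
qed

lemma Young_powr:
  fixes a b p :: real
  assumes p: "1 \<le> p" and "0 \<le> a" "0 \<le> b"
  shows "a * b powr (p - 1) \<le> (1 / p) * a powr p + (1 - 1 / p) * b powr p"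
proof (cases "p = 1")
  case True
  then show ?thesis
    using assms by (cases "b = 0") auto
next
  case False
  define q where "q = p / (p - 1)"
  have q: "1 < p" "1 < q" "1 / p + 1 / q = 1" "(p - 1) * q = p" and q': "1 / q = 1 - 1 / p"
    using p False by (auto simp: q_def field_simps)
  then show ?thesis
    using Youngs_inequality[of p q a "b powr (p - 1)"] assms
    unfolding q'[symmetric] by (simp add: powr_powr)
qed

lemma conjugate_exponent_cases:
  assumes p: "1 \<le> p" and pq: "1 / ennreal p + 1 / q = 1"
  shows "(q = \<infinity> \<and> p = 1) \<or> (q \<noteq> \<infinity> \<and> 1 < p \<and> 1 < enn2real q \<and> 1 / p + 1 / enn2real q = 1)"
proof -
  have one_p: "1 / ennreal p = ennreal (1 / p)"
    using p by (simp add: divide_ennreal flip: ennreal_1)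
  show ?thesis
  proof (cases q)
    case (real r)
    have "r \<noteq> 0"
    proof
      assume "r = 0"
      then have "1 / q = \<infinity>"
        using real by (simp add: divide_ennreal_def)
      then show False
        using pq by simp
    qed
    then have r: "0 < r"
      using real by simp
    have "1 / q = ennreal (1 / r)"
      using r real by (simp add: divide_ennreal flip: ennreal_1)
    then have "ennreal (1 / p + 1 / r) = ennreal 1"
      using pq one_p p r by (simp add: ennreal_plus[symmetric] del: ennreal_plus)
    then have eq: "1 / p + 1 / r = 1"
      using p r by (subst (asm) ennreal_inj) auto
    have "0 < 1 / p" "0 < 1 / r"
      using p r by auto
    then have "1 / p < 1" "1 / r < 1"
      using eq by linarith+
    then have "1 < p" "1 < r"
      using p r by (auto simp: field_simps)
    then show ?thesis
      using eq real by simp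
  next
    case top
    then have "ennreal (1 / p) = ennreal 1"
      using pq one_p by simp
    then have "p = 1"
      using p by (subst (asm) ennreal_inj) auto
    then show ?thesis
      using top by simp
  qed
qed

lemma Lq_fun_dual_fun:
  assumes p: "1 \<le> p" and pq: "1 / ennreal p + 1 / q = 1" and h: "h \<in> Lq_fun M q"
  obtains N where "dual_fun M p N h"
  using conjugate_exponent_cases[OF p pq]
proof
  assume q: "q = \<infinity> \<and> p = 1"
  then obtain C where [measurable]: "h \<in> borel_measurable M" and C: "AE t in M. norm (h t) \<le> C"
    using h by (auto simp: Lq_fun_def Linf_fun_def)
  have "dual_fun M p (max C 0 + (\<integral>t. 0 \<partial>M)) h"
  proof (rule dual_funI_Young)
    fix w :: "'a \<Rightarrow> complex"
    show "AE t in M. norm (w t) * norm (h t) \<le> max C 0 * norm (w t) powr p + 0"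
      using C
    proof eventually_elim
      case (elim t)
      then have "norm (w t) * norm (h t) \<le> norm (w t) * max C 0"
        by (intro mult_left_mono) auto
      then show ?case
        using q by (simp add: mult.commute)
    qed
  qed (use p in auto)
  then show ?thesis by (rule that)
next
  assume "q \<noteq> \<infinity> \<and> 1 < p \<and> 1 < enn2real q \<and> 1 / p + 1 / enn2real q = 1"
  then have q: "q \<noteq> \<infinity>" "1 < p" "1 < enn2real q" "1 / p + 1 / enn2real q = 1"
    by auto
  then have h': "h \<in> borel_measurable M" "integrable M (\<lambda>t. norm (h t) powr enn2real q)"
    using h by (auto simp: Lq_fun_def Lp_fun_def)
  have "dual_fun M p (1 / p + (\<integral>t. norm (h t) powr enn2real q / enn2real q \<partial>M)) h"
    using Youngs_inequality[OF q(2-4)] h' q(2,3) by (intro dual_funI_Young) auto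
  then show ?thesis by (rule that)
qed

text \<open>The extremal case of Hoelder's inequality: up to a constant, \<open>h\<close> is \<open>cnj (sgn u) \<bar>u\<bar> powr (p - 1)\<close>.  The
formula also serves for \<open>p = 1\<close>, where \<open>0 powr 0 = 0\<close> is harmless because \<open>sgn 0 = 0\<close>.\<close>

lemma norming_dual_fun:
  assumes p: "1 \<le> p" and u: "u \<in> Lp_fun M p"
  obtains h where "dual_fun M p 1 h" "(\<integral>t. u t * h t \<partial>M) = of_real (Lp_seminorm M p u)"
proof (cases "Lp_seminorm M p u = 0")
  case True
  show ?thesis
    by (rule that[of "\<lambda>_. 0"]) (simp_all add: dual_fun_def True)
next
  case False
  define S where "S = Lp_seminorm M p u"
  have S: "0 < S"
    using False Lp_seminorm_nonneg[of M p u] unfolding S_def by linarith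
  have p0: "0 < p" using p by simp
  have u_meas [measurable]: "u \<in> borel_measurable M" and int_u: "integrable M (\<lambda>t. norm (u t) powr p)"
    using u by (auto simp: Lp_fun_def)
  have int_S: "(\<integral>t. norm (u t) powr p \<partial>M) = S powr p"
    using Lp_seminorm_powr[OF p0, of M u] by (simp add: S_def)
  define h where "h t = cnj (sgn (u t)) * of_real ((norm (u t) / S) powr (p - 1))" for t
  have [measurable]: "h \<in> borel_measurable M"
    unfolding h_def sgn_div_norm
    by (intro borel_measurable_times borel_measurable_of_real
        borel_measurable_continuous_on[of cnj] continuous_on_cnj continuous_on_id) measurable
  have norm_h: "norm (h t) \<le> (norm (u t) / S) powr (p - 1)" for t
    by (simp add: h_def norm_mult norm_sgn)
  have "dual_fun M p (1 / p + (\<integral>t. (1 - 1 / p) * (norm (u t) / S) powr p \<partial>M)) h"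
  proof (rule dual_funI_Young)
    show "integrable M (\<lambda>t. (1 - 1 / p) * (norm (u t) / S) powr p)"
      using int_u S by (simp add: powr_divide)
    fix w :: "'a \<Rightarrow> complex"
    have "norm (w t) * norm (h t) \<le> (1 / p) * norm (w t) powr p + (1 - 1 / p) * (norm (u t) / S) powr p" for t
      using mult_left_mono[OF norm_h[of t], of "norm (w t)"] Young_powr[OF p, of "norm (w t)" "norm (u t) / S"] S
      by simp
    then show "AE t in M. norm (w t) * norm (h t)
        \<le> (1 / p) * norm (w t) powr p + (1 - 1 / p) * (norm (u t) / S) powr p"
      by simp
  qed (use p in auto)
  moreover have "1 / p + (\<integral>t. (1 - 1 / p) * (norm (u t) / S) powr p \<partial>M) = 1"
    using S by (simp add: powr_divide int_S)
  moreover have "(\<integral>t. u t * h t \<partial>M) = of_real S"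
  proof -
    have "u t * h t = of_real (norm (u t) powr p / S powr (p - 1))" for t
    proof (cases "u t = 0")
      case True
      then show ?thesis by simp
    next
      case False
      have "u t * h t = (u t * cnj (u t)) / of_real (norm (u t)) * of_real ((norm (u t) / S) powr (p - 1))"
        by (simp add: h_def sgn_div_norm scaleR_conv_of_real divide_inverse mult_ac)
      also have "u t * cnj (u t) / of_real (norm (u t)) = of_real (norm (u t))"
        using False by (simp add: complex_norm_square[symmetric] power2_eq_square)
      also have "of_real (norm (u t)) * of_real ((norm (u t) / S) powr (p - 1))
          = complex_of_real (norm (u t) powr p / S powr (p - 1))"
        using False S by (simp add: powr_divide powr_diff)
      finally show ?thesis .
    qed
    then have "(\<integral>t. u t * h t \<partial>M) = of_real (S powr p / S powr (p - 1))"
      by (simp add: int_S)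
    also have "S powr p / S powr (p - 1) = S"
      using S by (simp add: powr_diff)
    finally show ?thesis .
  qed
  ultimately show ?thesis
    using that[of h] by (simp add: S_def)
qed

lemma Lp_seminorm_le_by_duality:
  assumes "1 \<le> p" "u \<in> Lp_fun M p"
    and "\<And>N h. dual_fun M p N h \<Longrightarrow> norm (\<integral>t. u t * h t \<partial>M) \<le> N * K"
  shows "Lp_seminorm M p u \<le> K"
proof -
  obtain h where "dual_fun M p 1 h" "(\<integral>t. u t * h t \<partial>M) = of_real (Lp_seminorm M p u)"
    using norming_dual_fun[OF assms(1,2)] by metis
  then show ?thesis
    using assms(3)[of 1 h] by simp
qed

text \<open>Minkowski's inequality, as a consequence of duality.\<close>

lemma Lp_seminorm_triangle:
  assumes p: "1 \<le> p" and u: "u \<in> Lp_fun M p" and v: "v \<in> Lp_fun M p"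
  shows "Lp_seminorm M p (\<lambda>t. u t + v t) \<le> Lp_seminorm M p u + Lp_seminorm M p v"
proof (rule Lp_seminorm_le_by_duality[OF p])
  show "(\<lambda>t. u t + v t) \<in> Lp_fun M p"
    using p u v by (intro Lp_fun_add) auto
  fix N h assume h: "dual_fun M p N h"
  have "(\<integral>t. (u t + v t) * h t \<partial>M) = (\<integral>t. u t * h t \<partial>M) + (\<integral>t. v t * h t \<partial>M)"
    using dual_funD(3)[OF h] u v by (simp add: distrib_right)
  also have "norm \<dots> \<le> N * Lp_seminorm M p u + N * Lp_seminorm M p v"
    using dual_funD(4)[OF h] u v by (intro norm_triangle_mono) auto
  finally show "norm (\<integral>t. (u t + v t) * h t \<partial>M) \<le> N * (Lp_seminorm M p u + Lp_seminorm M p v)"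
    by (simp add: distrib_left)
qed

lemma Lp_seminorm_eq_0D:
  assumes "0 < p" "u \<in> Lp_fun M p" "Lp_seminorm M p u = 0"
  shows "AE t in M. u t = 0"
proof -
  have int_u: "integrable M (\<lambda>t. norm (u t) powr p)"
    using assms(2) by (simp add: Lp_fun_def)
  have "(\<integral>t. norm (u t) powr p \<partial>M) = 0"
    using Lp_seminorm_powr[OF assms(1), of M u] assms(3) by simp
  then have "AE t in M. norm (u t) powr p = 0"
    using integral_nonneg_eq_0_iff_AE[OF int_u] by simp
  then show ?thesis
    by eventually_elim simp
qed


section \<open>Families of bounded holomorphic functions\<close>

text \<open>The bound \<open>K\<close> is uniform only in the sense of \<open>L\<^sub>p\<close>: the bounds of the functions \<open>f(\<cdot>, t)\<close> on \<open>U\<close> may depend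
on \<open>t\<close> in an uncontrolled way, so that they cannot be integrated.\<close>

locale Lp_family =
  fixes M :: "'a measure" and p :: real and U :: "(complex ^ 'd) set"
    and f :: "complex ^ 'd \<Rightarrow> 'a \<Rightarrow> complex" and K :: real
  assumes p: "1 \<le> p" and U: "open U" "U \<noteq> {}"
    and Lp: "\<And>z. z \<in> U \<Longrightarrow> f z \<in> Lp_fun M p"
    and bound: "\<And>z. z \<in> U \<Longrightarrow> Lp_seminorm M p (f z) \<le> K"
    and Hinf: "\<And>t. t \<in> space M \<Longrightarrow> (\<lambda>z. f z t) \<in> Hinf U"
begin

lemma p_pos: "0 < p"
  using p by simp

lemma K_nonneg: "0 \<le> K"
  using U(2) bound Lp_seminorm_nonneg order_trans by blast

lemma holomorphic: "t \<in> space M \<Longrightarrow> holomorphic_vec (\<lambda>z. f z t) U"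
  using Hinf by (auto simp: Hinf_def)

lemma measurable: "z \<in> U \<Longrightarrow> f z \<in> borel_measurable M"
  using Lp by (auto simp: Lp_fun_def)

lemma measurable_cD:
  assumes z: "z \<in> U"
  shows "(\<lambda>t. cD (\<lambda>w. f w t) z v) \<in> borel_measurable M"
proof -
  obtain r where r: "0 < r" "ball z r \<subseteq> U"
    using U(1) z open_contains_ball by blast
  obtain s where s: "0 < s" "s * norm v < r"
    using small_scale_exists[of "norm v" r 0 1] r(1) by auto
  define e :: "nat \<Rightarrow> complex" where "e n = of_real (s / real (Suc n))" for n
  have norm_e: "norm (e n) = s / real (Suc n)" for n
    unfolding e_def norm_of_real using s(1) by simp
  then have e0: "e n \<noteq> 0" for n
    using s(1) norm_eq_zero[of "e n"] by simp
  have mem: "z + e n *s v \<in> U" for n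
  proof -
    have "norm (e n) \<le> s"
      unfolding norm_e using s(1) by (simp add: field_simps)
    then have "norm (e n *s v) < r"
      unfolding norm_vector_scale using mult_right_mono[of "norm (e n)" s "norm v"] s(2) by simp
    then show ?thesis
      using r(2) by (auto simp: subset_iff dist_norm)
  qed
  have "(\<lambda>n. s * (1 / real (Suc n))) \<longlonglongrightarrow> s * 0"
    by (intro tendsto_mult tendsto_const LIMSEQ_Suc lim_1_over_n)
  then have "(\<lambda>n. norm (e n)) \<longlonglongrightarrow> 0"
    by (simp add: norm_e)
  then have e_lim: "filterlim e (at 0) sequentially"
    using e0 by (simp add: filterlim_at tendsto_norm_zero_iff)
  show ?thesis
  proof (rule borel_measurable_LIMSEQ_metric)
    show "(\<lambda>t. (f (z + e n *s v) t - f z t) / e n) \<in> borel_measurable M" for n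
      by (intro borel_measurable_divide borel_measurable_diff measurable mem z) simp
    fix t assume t: "t \<in> space M"
    have "((\<lambda>s. f (z + s *s v) t) has_field_derivative cD (\<lambda>w. f w t) z v) (at 0)"
      using holomorphic_vec_line[OF holomorphic[OF t], of z 0 v] z by simp
    then have "((\<lambda>s. (f (z + s *s v) t - f z t) / s) \<longlongrightarrow> cD (\<lambda>w. f w t) z v) (at 0)"
      by (simp add: DERIV_def)
    then show "(\<lambda>n. (f (z + e n *s v) t - f z t) / e n) \<longlonglongrightarrow> cD (\<lambda>w. f w t) z v"
      using e_lim by (rule filterlim_compose)
  qed
qed

text \<open>For a scalar weight \<open>h\<close>, the function \<open>z \<mapsto> \<integral>t. f z t * h t \<partial>M\<close> is bounded by Hoelder's inequality.
It would be holomorphic by integration of the quadratic estimate if the functions \<open>f(\<cdot>, t)\<close> were bounded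
uniformly in \<open>t\<close> and \<open>h\<close> were integrable.  Both hold after truncation to suitable sets \<open>B n\<close>.  As \<open>n\<close> grows,
the truncated integrals converge pointwise and stay bounded by \<open>N * K\<close>, so that their limit is
holomorphic as well.\<close>

lemma
  assumes h: "dual_fun M p N h"
  shows pairing_bound: "z \<in> U \<Longrightarrow> norm (\<integral>t. f z t * h t \<partial>M) \<le> N * K"
    and pairing_holomorphic: "holomorphic_vec (\<lambda>z. \<integral>t. f z t * h t \<partial>M) U"
proof -
  have seminorm_le: "N * C \<le> N * K" if "C \<le> K" for C
    using dual_funD(2)[OF h] that by (intro mult_left_mono)
  show "norm (\<integral>t. f z t * h t \<partial>M) \<le> N * K" if "z \<in> U" for z
    using dual_funD(4)[OF h Lp[OF that]] seminorm_le[OF bound[OF that]] by linarith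
  obtain x :: "nat \<Rightarrow> complex ^ 'd" where x: "\<And>k. x k \<in> U"
    and dense: "\<And>z \<delta>. z \<in> U \<Longrightarrow> 0 < \<delta> \<Longrightarrow> \<exists>k. dist (x k) z < \<delta>"
    using dense_sequence[OF U(2)] by metis
  have h_meas [measurable]: "h \<in> borel_measurable M"
    using dual_funD(1)[OF h] .
  have fx_meas [measurable]: "f (x k) \<in> borel_measurable M" for k
    by (rule measurable[OF x])
  \<comment> \<open>The first condition bounds \<open>f(\<cdot>, t)\<close> by \<open>n\<close> on the dense sequence, hence on \<open>U\<close>.  The second makes the
    measure of \<open>B n\<close> finite by Chebyshev's inequality.  The union of all \<open>B n\<close> contains every \<open>t\<close> for
    which \<open>f(\<cdot>, t)\<close> is not identically zero on \<open>U\<close>.\<close>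
  define B where "B n = {t \<in> space M. (\<forall>k. norm (f (x k) t) \<le> real n) \<and>
      (\<exists>k\<le>n. 1 / real (Suc n) \<le> norm (f (x k) t))}" for n :: nat
  have B_sets [measurable]: "B n \<in> sets M" for n
    unfolding B_def by measurable
  define \<rho> where "\<rho> n t = (indicator (B n) t :: complex)" for n t
  have \<rho>_meas [measurable]: "\<rho> n \<in> borel_measurable M" for n
    unfolding \<rho>_def by measurable
  have norm_\<rho>: "norm (\<rho> n t) \<le> 1" for n t
    by (simp add: \<rho>_def indicator_def)
  have near: "\<exists>k. norm (f (x k) t - f z t) < \<epsilon>" if t: "t \<in> space M" and z: "z \<in> U" and \<epsilon>: "0 < \<epsilon>" for t z \<epsilon>
  proof -
    have "isCont (\<lambda>z. f z t) z"
      using has_derivative_continuous[OF holomorphic_vec_has_derivative[OF holomorphic[OF t] z]]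
      by simp
    then obtain \<delta> where "0 < \<delta>" "\<And>w. dist w z < \<delta> \<Longrightarrow> dist (f w t) (f z t) < \<epsilon>"
      using \<epsilon> unfolding continuous_at_eps_delta by blast
    then show ?thesis
      using dense[OF z] unfolding dist_norm by blast
  qed
  have B_bound: "norm (f z t) \<le> real n" if t: "t \<in> B n" and z: "z \<in> U" for n t z
  proof (rule field_le_epsilon)
    fix \<epsilon> :: real assume "0 < \<epsilon>"
    then obtain k where "norm (f (x k) t - f z t) < \<epsilon>"
      using near[of t z \<epsilon>] t z by (auto simp: B_def)
    moreover have "norm (f (x k) t) \<le> real n"
      using t by (auto simp: B_def)
    ultimately show "norm (f z t) \<le> real n + \<epsilon>"
      using norm_triangle_ineq4[of "f (x k) t" "f (x k) t - f z t"] by simp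
  qed
  have \<rho>_Lp: "\<rho> n \<in> Lp_fun M p" for n
  proof -
    have "integrable M (\<lambda>t. norm (\<rho> n t) powr p)"
    proof (rule Bochner_Integration.integrable_bound)
      show "integrable M (\<lambda>t. \<Sum>k\<le>n. real (Suc n) powr p * norm (f (x k) t) powr p)"
        using Lp[OF x] by (intro Bochner_Integration.integrable_sum integrable_mult_right) (simp add: Lp_fun_def)
      show "AE t in M. norm (norm (\<rho> n t) powr p)
          \<le> norm (\<Sum>k\<le>n. real (Suc n) powr p * norm (f (x k) t) powr p)"
      proof (rule AE_I2)
        fix t
        have nonneg: "0 \<le> (\<Sum>k\<le>n. real (Suc n) powr p * norm (f (x k) t) powr p)"
          by (intro sum_nonneg) auto
        show "norm (norm (\<rho> n t) powr p) \<le> norm (\<Sum>k\<le>n. real (Suc n) powr p * norm (f (x k) t) powr p)"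
        proof (cases "t \<in> B n")
          case True
          then obtain k where k: "k \<le> n" "1 / real (Suc n) \<le> norm (f (x k) t)"
            by (auto simp: B_def)
          have "1 powr p \<le> (real (Suc n) * norm (f (x k) t)) powr p"
            using k(2) p_pos by (intro powr_mono2) (auto simp: field_simps)
          also have "\<dots> = real (Suc n) powr p * norm (f (x k) t) powr p"
            by (rule powr_mult)
          also have "\<dots> \<le> (\<Sum>k\<le>n. real (Suc n) powr p * norm (f (x k) t) powr p)"
            using k(1) by (intro member_le_sum) auto
          finally show ?thesis
            using True nonneg by (simp add: \<rho>_def)
        next
          case False
          then show ?thesis
            by (simp add: \<rho>_def)
        qed
      qed
    qed measurable
    then show ?thesis
      by (simp add: Lp_fun_def)
  qed
  have int_\<rho>h: "integrable M (\<lambda>t. \<rho> n t * h t)" for n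
    by (rule dual_funD(3)[OF h \<rho>_Lp])
  define G where "G n z = (\<integral>t. f z t * (\<rho> n t * h t) \<partial>M)" for n z
  have G_int: "integrable M (\<lambda>t. f z t * (\<rho> n t * h t))" and G_bound: "norm (G n z) \<le> N * K"
    if z: "z \<in> U" for n z
  proof -
    have [measurable]: "f z \<in> borel_measurable M"
      by (rule measurable[OF z])
    have le: "norm (f z t * \<rho> n t) \<le> norm (f z t)" for t
      using norm_\<rho> by (simp add: norm_mult mult_left_le)
    have mem: "(\<lambda>t. f z t * \<rho> n t) \<in> Lp_fun M p"
      by (rule Lp_fun_dominated[OF p_pos _ Lp[OF z] le]) measurable
    have "Lp_seminorm M p (\<lambda>t. f z t * \<rho> n t) \<le> Lp_seminorm M p (f z)"
      by (rule Lp_seminorm_dominated[OF p_pos _ Lp[OF z] le]) measurable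
    also have "\<dots> \<le> K"
      by (rule bound[OF z])
    finally have "N * Lp_seminorm M p (\<lambda>t. f z t * \<rho> n t) \<le> N * K"
      by (rule seminorm_le)
    then show "norm (G n z) \<le> N * K"
      using dual_funD(4)[OF h mem] unfolding G_def by (simp add: mult.assoc)
    show "integrable M (\<lambda>t. f z t * (\<rho> n t * h t))"
      using dual_funD(3)[OF h mem] by (simp add: mult.assoc)
  qed
  have G_holo: "holomorphic_vec (G n) U" for n
    unfolding holomorphic_vec_def
  proof
    fix z assume z: "z \<in> U"
    obtain r where r: "0 < r" "ball z r \<subseteq> U"
      using U(1) z open_contains_ball by blast
    define D where "D t v = cD (\<lambda>w. f w t) z v" for t v
    have D_meas [measurable]: "(\<lambda>t. D t v) \<in> borel_measurable M" for v
      unfolding D_def by (rule measurable_cD[OF z])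
    have est: "norm (D t v) \<le> 2 * real n / r * norm v"
      "norm v < r / 2 \<Longrightarrow> norm (f (z + v) t - f z t - D t v) \<le> 8 * real n / r\<^sup>2 * (norm v)\<^sup>2"
      if t: "t \<in> B n" for t v
    proof -
      have "t \<in> space M"
        using t by (simp add: B_def)
      note est = bounded_holomorphic_vec_estimates[OF holomorphic[OF this] r(2,1), of "real n" v]
      show "norm (D t v) \<le> 2 * real n / r * norm v"
        "norm v < r / 2 \<Longrightarrow> norm (f (z + v) t - f z t - D t v) \<le> 8 * real n / r\<^sup>2 * (norm v)\<^sup>2"
        unfolding D_def using est(1,3) B_bound[OF t] r(2) by blast+
    qed
    have zero: "\<rho> n t = 0" if "t \<notin> B n" for t
      using that by (simp add: \<rho>_def)
    have D_int: "integrable M (\<lambda>t. D t v * (\<rho> n t * h t))" for v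
    proof (rule Bochner_Integration.integrable_bound)
      show "integrable M (\<lambda>t. (2 * real n / r * norm v) * norm (\<rho> n t * h t))"
        by (intro integrable_mult_right integrable_norm int_\<rho>h)
      have "norm (D t v * (\<rho> n t * h t)) \<le> (2 * real n / r * norm v) * norm (\<rho> n t * h t)" for t
      proof (cases "t \<in> B n")
        case True
        show ?thesis
          using mult_right_mono[OF est(1)[OF True], of "norm (\<rho> n t * h t)" v]
          by (simp only: norm_mult[of "D t v"] norm_ge_zero simp_thms)
      next
        case False
        then show ?thesis by (simp add: zero)
      qed
      moreover have "0 \<le> (2 * real n / r * norm v) * norm (\<rho> n t * h t)" for t
        using r(1) by simp
      ultimately show "AE t in M. norm (D t v * (\<rho> n t * h t)) \<le> norm ((2 * real n / r * norm v) * norm (\<rho> n t * h t))"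
        by (intro AE_I2) (metis abs_of_nonneg real_norm_def)
    qed measurable
    define L where "L v = (\<integral>t. D t v * (\<rho> n t * h t) \<partial>M)" for v
    have L_scale: "L (c *s v) = c * L v" for c v
    proof -
      have "L (c *s v) = (\<integral>t. c * (D t v * (\<rho> n t * h t)) \<partial>M)"
        unfolding L_def D_def
        by (intro Bochner_Integration.integral_cong) (auto simp: cD_scale[OF holomorphic z])
      then show ?thesis
        by (simp add: L_def)
    qed
    have L_add: "L (v + w) = L v + L w" for v w
    proof -
      have "L (v + w) = (\<integral>t. D t v * (\<rho> n t * h t) + D t w * (\<rho> n t * h t) \<partial>M)"
        unfolding L_def D_def
        by (intro Bochner_Integration.integral_cong) (auto simp: cD_add[OF holomorphic z] distrib_right)
      also have "\<dots> = L v + L w"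
        unfolding L_def by (rule Bochner_Integration.integral_add[OF D_int D_int])
      finally show ?thesis .
    qed
    define C where "C = 8 * real n / r\<^sup>2 * (\<integral>t. norm (\<rho> n t * h t) \<partial>M)"
    have quad: "norm (G n (z + v) - G n z - L v) \<le> C * (norm v)\<^sup>2" if v: "norm v < r / 2" for v
    proof -
      have zv: "z + v \<in> U"
        using v r by (auto simp: subset_iff dist_norm)
      have int: "integrable M (\<lambda>t. (f (z + v) t - f z t - D t v) * (\<rho> n t * h t))"
        unfolding left_diff_distrib by (intro Bochner_Integration.integrable_diff G_int zv z D_int)
      have "G n (z + v) - G n z - L v = (\<integral>t. (f (z + v) t - f z t - D t v) * (\<rho> n t * h t) \<partial>M)"
        unfolding G_def L_def left_diff_distrib
        using G_int[OF zv] G_int[OF z] D_int by simp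
      also have "norm \<dots> \<le> (\<integral>t. norm ((f (z + v) t - f z t - D t v) * (\<rho> n t * h t)) \<partial>M)"
        by (rule integral_norm_bound)
      also have "\<dots> \<le> (\<integral>t. (8 * real n / r\<^sup>2 * (norm v)\<^sup>2) * norm (\<rho> n t * h t) \<partial>M)"
      proof (rule integral_mono)
        show "integrable M (\<lambda>t. (8 * real n / r\<^sup>2 * (norm v)\<^sup>2) * norm (\<rho> n t * h t))"
          by (intro integrable_mult_right integrable_norm int_\<rho>h)
        fix t
        show "norm ((f (z + v) t - f z t - D t v) * (\<rho> n t * h t))
            \<le> (8 * real n / r\<^sup>2 * (norm v)\<^sup>2) * norm (\<rho> n t * h t)"
        proof (cases "t \<in> B n")
          case True
          show ?thesis
            using mult_right_mono[OF est(2)[OF True v], of "norm (\<rho> n t * h t)"]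
            by (simp only: norm_mult[of "f (z + v) t - f z t - D t v"] norm_ge_zero simp_thms)
        next
          case False
          then show ?thesis by (simp add: zero)
        qed
      qed (rule integrable_norm[OF int])
      also have "\<dots> = C * (norm v)\<^sup>2"
        by (simp add: C_def)
      finally show ?thesis .
    qed
    have "(G n has_derivative L) (at z)"
      using r(1) by (intro has_derivativeI_quadratic[where r = "r / 2" and K = C] L_add L_scale quad) auto
    then show "\<exists>D. (G n has_derivative D) (at z) \<and> (\<forall>c v. D (c *s v) = c * D v)"
      using L_scale by blast
  qed
  have G_lim: "(\<lambda>n. G n z) \<longlonglongrightarrow> (\<integral>t. f z t * h t \<partial>M)" if z: "z \<in> U" for z
    unfolding G_def
  proof (rule integral_dominated_convergence)
    have [measurable]: "f z \<in> borel_measurable M"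
      by (rule measurable[OF z])
    show "(\<lambda>t. f z t * h t) \<in> borel_measurable M" "\<And>n. (\<lambda>t. f z t * (\<rho> n t * h t)) \<in> borel_measurable M"
      by measurable
    show "integrable M (\<lambda>t. norm (f z t * h t))"
      by (intro integrable_norm dual_funD(3)[OF h Lp[OF z]])
    show "AE t in M. norm (f z t * (\<rho> n t * h t)) \<le> norm (f z t * h t)" for n
      by (intro AE_I2) (simp add: norm_mult \<rho>_def indicator_def)
    show "AE t in M. (\<lambda>n. f z t * (\<rho> n t * h t)) \<longlonglongrightarrow> f z t * h t"
    proof (rule AE_I2)
      fix t assume t: "t \<in> space M"
      show "(\<lambda>n. f z t * (\<rho> n t * h t)) \<longlonglongrightarrow> f z t * h t"
      proof (cases "f z t = 0")
        case False
        \<comment> \<open>As \<open>f(\<cdot>, t)\<close> does not vanish identically, it is nonzero at some \<open>x k\<close>, so \<open>t\<close> lies in \<open>B n\<close> for all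
          large \<open>n\<close>.\<close>
        obtain k where k: "norm (f (x k) t - f z t) < norm (f z t)"
          using near[OF t z, of "norm (f z t)"] False by auto
        then have "0 < norm (f (x k) t)"
          by auto
        then obtain n1 where n1: "1 / real (Suc n1) < norm (f (x k) t)"
          using nat_approx_posE by blast
        obtain b where b: "\<And>z. z \<in> U \<Longrightarrow> norm (f z t) \<le> b"
          using Hinf_obtain_bound[OF Hinf[OF t]] by metis
        obtain n2 where n2: "b \<le> real n2"
          using real_arch_simple by blast
        have "t \<in> B n" if n: "max k (max n1 n2) \<le> n" for n
        proof -
          have "norm (f (x k) t) \<le> real n" for k
            using b[OF x, of k] n2 n by simp
          moreover have "1 / real (Suc n) \<le> 1 / real (Suc n1)"
            using n by (intro divide_left_mono) auto
          then have "1 / real (Suc n) \<le> norm (f (x k) t)" "k \<le> n"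
            using n1 n by auto
          ultimately show ?thesis
            using t unfolding B_def by blast
        qed
        then have "\<forall>\<^sub>F n in sequentially. f z t * (\<rho> n t * h t) = f z t * h t"
          unfolding eventually_sequentially \<rho>_def by (intro exI[of _ "max k (max n1 n2)"]) simp
        then show ?thesis
          by (rule tendsto_eventually)
      qed simp
    qed
  qed
  show "holomorphic_vec (\<lambda>z. \<integral>t. f z t * h t \<partial>M) U"
    by (rule bounded_pointwise_limit(1)[where g = G, OF U(1) G_holo G_bound G_lim])
qed

lemma pairing_Hinf: "dual_fun M p N h \<Longrightarrow> (\<lambda>z. \<integral>t. f z t * h t \<partial>M) \<in> Hinf U"
  by (rule HinfI[OF pairing_holomorphic pairing_bound])

text \<open>For a finite combination of evaluations \<open>\<psi>\<^sub>n g = \<Sum>k<N. c k * g (x k)\<close> the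
function \<open>u n\<close>, given by \<open>t \<mapsto> \<psi>\<^sub>n (f(\<cdot>, t))\<close>, is the same combination of the functions \<open>f (x k)\<close>, and the
pairing formula is linearity of the integral.  Let \<open>\<psi>\<^sub>n\<close> converge to \<open>\<psi>\<close> in norm.  Then \<open>u n\<close> converges
pointwise to \<open>v\<close>, given by \<open>t \<mapsto> \<psi> (f(\<cdot>, t))\<close>.  This convergence also takes place in \<open>L\<^sub>p\<close>: by duality and
the pairing formula, the norm of \<open>u n - u m\<close> is at most \<open>K\<close> times the norm of \<open>\<psi>\<^sub>n - \<psi>\<^sub>m\<close> as a functional
on bounded holomorphic functions, however large the coefficients are.  Fatou's lemma turns the Cauchy property
into convergence to \<open>v\<close>, and all assertions pass to the limit.\<close>

lemma functional_of_family:
  assumes lin: "Hinf_linear U \<psi>" and bp: "bp_continuous U \<psi>"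
    and A: "\<And>g. g \<in> Hinf_unit_ball U \<Longrightarrow> norm (\<psi> g) \<le> A"
  shows functional_Lp: "(\<lambda>t. \<psi> (\<lambda>z. f z t)) \<in> Lp_fun M p"
    and functional_seminorm: "Lp_seminorm M p (\<lambda>t. \<psi> (\<lambda>z. f z t)) \<le> A * K"
    and functional_pairing: "dual_fun M p N h \<Longrightarrow>
      (\<integral>t. \<psi> (\<lambda>z. f z t) * h t \<partial>M) = \<psi> (\<lambda>z. \<integral>t. f z t * h t \<partial>M)"
    and functional_approx: "0 < \<epsilon> \<Longrightarrow> \<exists>x c (N::nat). (\<forall>k. x k \<in> U) \<and>
      Lp_seminorm M p (\<lambda>t. \<psi> (\<lambda>z. f z t) - (\<Sum>k<N. c k * f (x k) t)) < \<epsilon>"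
proof -
  \<comment> \<open>Bundling points, coefficients and length into one object allows a single choice for all \<open>n\<close>.\<close>
  define good where "good n y \<longleftrightarrow> (case y of (x, c, N) \<Rightarrow> (\<forall>k. x k \<in> U) \<and>
      (\<forall>h\<in>Hinf_unit_ball U. norm (\<psi> h - (\<Sum>k<N. c k * h (x k))) \<le> 1 / real (Suc n)))"
    for n :: nat and y :: "(nat \<Rightarrow> complex ^ 'd) \<times> (nat \<Rightarrow> complex) \<times> nat"
  have "\<exists>y. good n y" for n
  proof (rule bp_continuous_approximation[OF U lin bp, of "1 / real (Suc n)"])
    fix x :: "nat \<Rightarrow> complex ^ 'd" and c :: "nat \<Rightarrow> complex" and N :: nat
    assume "\<And>k. x k \<in> U" "\<And>h. h \<in> Hinf_unit_ball U \<Longrightarrow> norm (\<psi> h - (\<Sum>k<N. c k * h (x k))) \<le> 1 / real (Suc n)"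
    then show ?thesis
      by (intro exI[of _ "(x, c, N)"]) (simp add: good_def)
  qed simp
  then have "\<exists>y. \<forall>n. good n (y n)"
    by (intro choice) simp
  then obtain y where y: "\<And>n. good n (y n)"
    by blast
  define x c N where "x n = fst (y n)" and "c n = fst (snd (y n))" and "N n = snd (snd (y n))" for n
  have x: "x n k \<in> U" and
    approx: "h \<in> Hinf_unit_ball U \<Longrightarrow> norm (\<psi> h - (\<Sum>k<N n. c n k * h (x n k))) \<le> 1 / real (Suc n)" for n k h
    using y[of n] by (auto simp: good_def x_def c_def N_def split: prod.splits)
  define \<delta> where "\<delta> n g = \<psi> g - (\<Sum>k<N n. c n k * g (x n k))" for n g
  have \<delta>_lin: "Hinf_linear U (\<delta> n)" for n
    using lin unfolding Hinf_linear_def \<delta>_def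
    by (auto simp: distrib_left sum.distrib right_diff_distrib sum_distrib_left mult.left_commute)
  have \<delta>_bound: "norm (\<delta> n g) \<le> b / real (Suc n)"
    if "g \<in> Hinf U" "\<And>z. z \<in> U \<Longrightarrow> norm (g z) \<le> b" "0 \<le> b" for n g b
  proof -
    have "norm (\<delta> n g) \<le> 1 / real (Suc n) * b"
      using approx by (intro Hinf_norm_bound_scale[OF \<delta>_lin _ that]) (simp add: \<delta>_def)
    then show ?thesis by simp
  qed
  define u where "u n t = (\<Sum>k<N n. c n k * f (x n k) t)" for n t
  define v where "v = (\<lambda>t. \<psi> (\<lambda>z. f z t))"
  have u_Lp: "u n \<in> Lp_fun M p" for n
    unfolding u_def by (intro Lp_fun_sum p_pos Lp x)
  have u_pairing: "(\<integral>t. u n t * h t \<partial>M) = \<psi> (\<lambda>z. \<integral>t. f z t * h t \<partial>M) - \<delta> n (\<lambda>z. \<integral>t. f z t * h t \<partial>M)"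
    if h: "dual_fun M p C h" for n C h
  proof -
    have "(\<integral>t. u n t * h t \<partial>M) = (\<integral>t. (\<Sum>k<N n. c n k * (f (x n k) t * h t)) \<partial>M)"
      by (simp add: u_def sum_distrib_right mult.assoc)
    also have "\<dots> = (\<Sum>k<N n. c n k * (\<integral>t. f (x n k) t * h t \<partial>M))"
      using dual_funD(3)[OF h Lp[OF x]] by (simp add: Bochner_Integration.integral_sum)
    finally show ?thesis
      by (simp add: \<delta>_def)
  qed
  have pairing_\<delta>: "norm (\<delta> n (\<lambda>z. \<integral>t. f z t * h t \<partial>M)) \<le> C * K / real (Suc n)"
    if h: "dual_fun M p C h" for n C h
    by (rule \<delta>_bound[OF pairing_Hinf[OF h] pairing_bound[OF h]]) (use dual_funD(2)[OF h] K_nonneg in auto)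
  have v_lim: "(\<lambda>n. u n t) \<longlonglongrightarrow> v t" if t: "t \<in> space M" for t
  proof -
    obtain b where b: "0 \<le> b" "\<And>z. z \<in> U \<Longrightarrow> norm (f z t) \<le> b"
      using Hinf_obtain_bound[OF Hinf[OF t]] by metis
    have "(\<lambda>n. v t - u n t) \<longlonglongrightarrow> 0"
    proof (rule Lim_null_comparison)
      show "\<forall>\<^sub>F n in sequentially. norm (v t - u n t) \<le> b * (1 / real (Suc n))"
        using \<delta>_bound[OF Hinf[OF t] b(2,1)] by (simp add: \<delta>_def u_def v_def)
      show "(\<lambda>n. b * (1 / real (Suc n))) \<longlonglongrightarrow> 0"
        by (rule tendsto_mult_right_zero) (intro LIMSEQ_Suc lim_1_over_n)
    qed
    from tendsto_diff[OF tendsto_const[of "v t"] this] show ?thesis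
      by simp
  qed
  have u_dist: "Lp_seminorm M p (\<lambda>t. u n t - u (n + m) t) \<le> 2 * K / real (Suc n)" for n m
  proof (rule Lp_seminorm_le_by_duality[OF p])
    show "(\<lambda>t. u n t - u (n + m) t) \<in> Lp_fun M p"
      by (intro Lp_fun_diff p_pos u_Lp)
    fix C h assume h: "dual_fun M p C h"
    have "(\<integral>t. (u n t - u (n + m) t) * h t \<partial>M) = (\<integral>t. u n t * h t \<partial>M) - (\<integral>t. u (n + m) t * h t \<partial>M)"
      using dual_funD(3)[OF h u_Lp] by (simp add: left_diff_distrib)
    also have "\<dots> = \<delta> (n + m) (\<lambda>z. \<integral>t. f z t * h t \<partial>M) - \<delta> n (\<lambda>z. \<integral>t. f z t * h t \<partial>M)"
      by (simp add: u_pairing[OF h])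
    also have "norm \<dots> \<le> C * K / real (Suc (n + m)) + C * K / real (Suc n)"
      using norm_triangle_ineq4 add_mono[OF pairing_\<delta>[OF h] pairing_\<delta>[OF h]] by (rule order_trans)
    also have "\<dots> \<le> C * K / real (Suc n) + C * K / real (Suc n)"
      using dual_funD(2)[OF h] K_nonneg by (intro add_mono divide_left_mono) auto
    finally show "norm (\<integral>t. (u n t - u (n + m) t) * h t \<partial>M) \<le> C * (2 * K / real (Suc n))"
      by (simp add: mult.left_commute)
  qed
  have uv: "(\<lambda>t. u n t - v t) \<in> Lp_fun M p" "Lp_seminorm M p (\<lambda>t. u n t - v t) \<le> 2 * K / real (Suc n)" for n
  proof -
    have lim: "(\<lambda>m. u n t - u (n + m) t) \<longlonglongrightarrow> u n t - v t" if "t \<in> space M" for t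
      using LIMSEQ_ignore_initial_segment[OF v_lim[OF that], of n]
      by (intro tendsto_diff tendsto_const) (simp add: add.commute)
    show "(\<lambda>t. u n t - v t) \<in> Lp_fun M p"
      by (rule Lp_Fatou(1)[OF p_pos _ u_dist lim]) (intro Lp_fun_diff p_pos u_Lp)
    show "Lp_seminorm M p (\<lambda>t. u n t - v t) \<le> 2 * K / real (Suc n)"
      by (rule Lp_Fatou(2)[OF p_pos _ u_dist lim]) (intro Lp_fun_diff p_pos u_Lp)
  qed
  have v_Lp: "v \<in> Lp_fun M p"
    using Lp_fun_diff[OF p_pos u_Lp[of 0] uv(1)[of 0]] by simp
  then show "(\<lambda>t. \<psi> (\<lambda>z. f z t)) \<in> Lp_fun M p"
    by (simp add: v_def)
  have v_pairing: "(\<integral>t. v t * h t \<partial>M) = \<psi> (\<lambda>z. \<integral>t. f z t * h t \<partial>M)" if h: "dual_fun M p C h" for C h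
  proof -
    define g where "g = (\<lambda>z. \<integral>t. f z t * h t \<partial>M)"
    have "norm ((\<integral>t. v t * h t \<partial>M) - \<psi> g) \<le> 3 * C * K * (1 / real (Suc n))" for n
    proof -
      have "(\<integral>t. v t * h t \<partial>M) - \<psi> g = - (\<integral>t. (u n t - v t) * h t \<partial>M) - \<delta> n g"
        using dual_funD(3)[OF h u_Lp[of n]] dual_funD(3)[OF h v_Lp] u_pairing[OF h, of n]
        by (simp add: left_diff_distrib g_def)
      also have "norm \<dots> \<le> norm (\<integral>t. (u n t - v t) * h t \<partial>M) + norm (\<delta> n g)"
        using norm_triangle_ineq4[of "- (\<integral>t. (u n t - v t) * h t \<partial>M)" "\<delta> n g"] by simp
      also have "\<dots> \<le> C * (2 * K / real (Suc n)) + C * K / real (Suc n)"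
        using dual_funD(4)[OF h uv(1)[of n]] mult_left_mono[OF uv(2)[of n] dual_funD(2)[OF h]]
          pairing_\<delta>[OF h, of n] unfolding g_def by linarith
      finally show ?thesis
        by simp
    qed
    moreover have "(\<lambda>n. 3 * C * K * (1 / real (Suc n))) \<longlonglongrightarrow> 0"
      by (rule tendsto_mult_right_zero) (intro LIMSEQ_Suc lim_1_over_n)
    ultimately have "norm ((\<integral>t. v t * h t \<partial>M) - \<psi> g) \<le> 0"
      by (intro LIMSEQ_le_const) auto
    then show ?thesis
      by (simp add: g_def)
  qed
  then show "dual_fun M p C h \<Longrightarrow>
      (\<integral>t. \<psi> (\<lambda>z. f z t) * h t \<partial>M) = \<psi> (\<lambda>z. \<integral>t. f z t * h t \<partial>M)" for C h
    by (simp add: v_def)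
  have "Lp_seminorm M p v \<le> A * K"
  proof (rule Lp_seminorm_le_by_duality[OF p v_Lp])
    fix C h assume h: "dual_fun M p C h"
    have "norm (\<psi> (\<lambda>z. \<integral>t. f z t * h t \<partial>M)) \<le> A * (C * K)"
      using dual_funD(2)[OF h] K_nonneg
      by (intro Hinf_norm_bound_scale[OF lin A pairing_Hinf[OF h] pairing_bound[OF h]]) auto
    then show "norm (\<integral>t. v t * h t \<partial>M) \<le> C * (A * K)"
      unfolding v_pairing[OF h] by (simp add: mult.left_commute)
  qed
  then show "Lp_seminorm M p (\<lambda>t. \<psi> (\<lambda>z. f z t)) \<le> A * K"
    by (simp add: v_def)
  show "\<exists>x c (N::nat). (\<forall>k. x k \<in> U) \<and>
      Lp_seminorm M p (\<lambda>t. \<psi> (\<lambda>z. f z t) - (\<Sum>k<N. c k * f (x k) t)) < \<epsilon>" if \<epsilon>: "0 < \<epsilon>"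
  proof -
    have "(\<lambda>n. 2 * K * (1 / real (Suc n))) \<longlonglongrightarrow> 0"
      by (rule tendsto_mult_right_zero) (intro LIMSEQ_Suc lim_1_over_n)
    then have "\<forall>\<^sub>F n in sequentially. 2 * K * (1 / real (Suc n)) < \<epsilon>"
      using \<epsilon> by (rule order_tendstoD(2))
    then obtain n where n: "2 * K / real (Suc n) < \<epsilon>"
      by (auto simp: eventually_sequentially)
    have "Lp_seminorm M p (\<lambda>t. v t - u n t) = Lp_seminorm M p (\<lambda>t. u n t - v t)"
      by (simp add: Lp_seminorm_def norm_minus_commute)
    then have "Lp_seminorm M p (\<lambda>t. v t - u n t) < \<epsilon>"
      using uv(2)[of n] n by linarith
    then show ?thesis
      using x by (intro exI[of _ "x n"] exI[of _ "c n"] exI[of _ "N n"]) (simp add: u_def v_def)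
  qed
qed

end


section \<open>Derivatives of families\<close>

lemma Hinf_linear_cD:
  assumes "z \<in> U"
  shows "Hinf_linear U (\<lambda>g. cD g z v)"
  unfolding Hinf_linear_def
proof (intro conjI ballI allI)
  fix g h assume "g \<in> Hinf U" "h \<in> Hinf U"
  then have "((\<lambda>w. g w + h w) has_derivative (\<lambda>v. cD g z v + cD h z v)) (at z)"
    using assms by (intro has_derivative_add holomorphic_vec_has_derivative) (auto simp: Hinf_def)
  from frechet_derivative_at[OF this] show "cD (\<lambda>w. g w + h w) z v = cD g z v + cD h z v"
    by metis
next
  fix c g assume "g \<in> Hinf U"
  then have "((\<lambda>w. c * g w) has_derivative (\<lambda>v. c * cD g z v)) (at z)"
    using assms by (intro has_derivative_mult_right holomorphic_vec_has_derivative) (auto simp: Hinf_def)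
  from frechet_derivative_at[OF this] show "cD (\<lambda>w. c * g w) z v = c * cD g z v"
    by metis
qed

lemma bp_continuous_cD:
  assumes U: "open U" and z: "z \<in> U"
  shows "bp_continuous U (\<lambda>g. cD g z v)"
  unfolding bp_continuous_def
proof (intro allI impI)
  fix g l assume g: "\<forall>n. g n \<in> Hinf U" and conv: "bp_converges U g l"
  obtain C where C: "\<forall>n. \<forall>z\<in>U. norm (g n z) \<le> C"
    using conv by (auto simp: bp_converges_def)
  show "(\<lambda>n. cD (g n) z v) \<longlonglongrightarrow> cD l z v"
  proof (rule bounded_pointwise_limit(2)[OF U _ _ _ z])
    show "holomorphic_vec (g n) U" for n
      using g by (simp add: Hinf_def)
    show "norm (g n w) \<le> C" if "w \<in> U" for n w
      using C that by blast
    show "(\<lambda>n. g n w) \<longlonglongrightarrow> l w" if "w \<in> U" for w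
      using conv that by (simp add: bp_converges_def)
  qed
qed

lemma remainder_functional:
  assumes U: "open U" and z: "z \<in> U" and zv: "z + v \<in> U"
  shows Hinf_linear_remainder: "Hinf_linear U (\<lambda>g. g (z + v) - g z - cD g z v)"
    and bp_continuous_remainder: "bp_continuous U (\<lambda>g. g (z + v) - g z - cD g z v)"
proof -
  show "Hinf_linear U (\<lambda>g. g (z + v) - g z - cD g z v)"
    using Hinf_linear_cD[OF z, of v] unfolding Hinf_linear_def
    by (auto simp: right_diff_distrib)
  show "bp_continuous U (\<lambda>g. g (z + v) - g z - cD g z v)"
    unfolding bp_continuous_def
  proof (intro allI impI)
    fix g l assume gl: "\<forall>n. g n \<in> Hinf U" "l \<in> Hinf U" "bp_converges U g l"
    then have "(\<lambda>n. cD (g n) z v) \<longlonglongrightarrow> cD l z v"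
      using bp_continuousD[OF bp_continuous_cD[OF U z, of v], of g l] by simp
    moreover have "(\<lambda>n. g n (z + v)) \<longlonglongrightarrow> l (z + v)" "(\<lambda>n. g n z) \<longlonglongrightarrow> l z"
      using gl(3) z zv by (auto simp: bp_converges_def)
    ultimately show "(\<lambda>n. g n (z + v) - g n z - cD (g n) z v) \<longlonglongrightarrow> l (z + v) - l z - cD l z v"
      by (intro tendsto_diff)
  qed
qed

context Lp_family
begin

text \<open>The derivative at \<open>z\<close> in a direction \<open>v\<close> is itself a bp-continuous functional, by convergence of derivatives
along bounded pointwise limits, with norm at most \<open>2 \<bar>v\<bar> / r\<close>.\<close>

lemma derivative_Lp:
  assumes z: "z \<in> U" and r: "0 < r" "ball z r \<subseteq> U"
  shows derivative_in_Lp: "(\<lambda>t. cD (\<lambda>w. f w t) z v) \<in> Lp_fun M p"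
    and derivative_seminorm: "Lp_seminorm M p (\<lambda>t. cD (\<lambda>w. f w t) z v) \<le> 2 * K / r * norm v"
proof -
  have "norm (cD g z v) \<le> 2 / r * norm v" if "g \<in> Hinf_unit_ball U" for g
    using bounded_holomorphic_vec_estimates(1)[of g U z r 1 v] that r
    by (auto simp: Hinf_unit_ball_def Hinf_def subset_iff)
  note * = Hinf_linear_cD[OF z, of v] bp_continuous_cD[OF U(1) z, of v] this
  show "(\<lambda>t. cD (\<lambda>w. f w t) z v) \<in> Lp_fun M p"
    by (rule functional_Lp[OF *])
  have "Lp_seminorm M p (\<lambda>t. cD (\<lambda>w. f w t) z v) \<le> 2 / r * norm v * K"
    by (rule functional_seminorm[OF *])
  then show "Lp_seminorm M p (\<lambda>t. cD (\<lambda>w. f w t) z v) \<le> 2 * K / r * norm v"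
    by (simp add: mult_ac)
qed

lemma derivative_pairing:
  assumes z: "z \<in> U" and h: "dual_fun M p N h"
  shows "(\<integral>t. cD (\<lambda>w. f w t) z v * h t \<partial>M) = cD (\<lambda>w. \<integral>t. f w t * h t \<partial>M) z v"
proof -
  obtain r where r: "0 < r" "ball z r \<subseteq> U"
    using U(1) z open_contains_ball by blast
  have "norm (cD g z v) \<le> 2 / r * norm v" if "g \<in> Hinf_unit_ball U" for g
    using bounded_holomorphic_vec_estimates(1)[of g U z r 1 v] that r
    by (auto simp: Hinf_unit_ball_def Hinf_def subset_iff)
  then show ?thesis
    by (rule functional_pairing[OF Hinf_linear_cD[OF z, of v] bp_continuous_cD[OF U(1) z, of v] _ h])
qed

text \<open>The error of the linear approximation is a bp-continuous functional with norm \<open>O(\<bar>v\<bar>\<^sup>2)\<close>.  The norm estimate for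
functionals carries this over to the \<open>L\<^sub>p\<close>-valued map, whose differentiability is thereby reduced to
the scalar estimate.\<close>

lemma remainder_Lp:
  assumes z: "z \<in> U" and r: "0 < r" "ball z r \<subseteq> U" and v: "norm v < r / 2"
  shows remainder_in_Lp: "(\<lambda>t. f (z + v) t - f z t - cD (\<lambda>w. f w t) z v) \<in> Lp_fun M p"
    and remainder_seminorm:
      "Lp_seminorm M p (\<lambda>t. f (z + v) t - f z t - cD (\<lambda>w. f w t) z v) \<le> 8 * K / r\<^sup>2 * (norm v)\<^sup>2"
proof -
  have zv: "z + v \<in> U"
    using v r by (auto simp: subset_iff dist_norm)
  have "norm (g (z + v) - g z - cD g z v) \<le> 8 / r\<^sup>2 * (norm v)\<^sup>2" if "g \<in> Hinf_unit_ball U" for g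
    using bounded_holomorphic_vec_estimates(3)[of g U z r 1 v] that r v
    by (auto simp: Hinf_unit_ball_def Hinf_def subset_iff)
  note * = Hinf_linear_remainder[OF U(1) z zv] bp_continuous_remainder[OF U(1) z zv] this
  show "(\<lambda>t. f (z + v) t - f z t - cD (\<lambda>w. f w t) z v) \<in> Lp_fun M p"
    by (rule functional_Lp[OF *])
  have "Lp_seminorm M p (\<lambda>t. f (z + v) t - f z t - cD (\<lambda>w. f w t) z v) \<le> 8 / r\<^sup>2 * (norm v)\<^sup>2 * K"
    by (rule functional_seminorm[OF *])
  then show "Lp_seminorm M p (\<lambda>t. f (z + v) t - f z t - cD (\<lambda>w. f w t) z v) \<le> 8 * K / r\<^sup>2 * (norm v)\<^sup>2"
    by (simp add: mult_ac)
qed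

lemma Lp_class_remainder:
  assumes z: "z \<in> U" and r: "0 < r" "ball z r \<subseteq> U" and v: "norm v < r / 2"
  shows "Lp_norm M p (Lp_diff M p (Lp_diff M p (Lp_class M p (f (z + v))) (Lp_class M p (f z)))
      (Lp_class M p (\<lambda>t. cD (\<lambda>w. f w t) z v))) \<le> 8 * K / r\<^sup>2 * (norm v)\<^sup>2"
proof -
  have zv: "z + v \<in> U"
    using v r by (auto simp: subset_iff dist_norm)
  have "Lp_diff M p (Lp_diff M p (Lp_class M p (f (z + v))) (Lp_class M p (f z)))
      (Lp_class M p (\<lambda>t. cD (\<lambda>w. f w t) z v))
    = Lp_class M p (\<lambda>t. f (z + v) t - f z t - cD (\<lambda>w. f w t) z v)"
    using Lp[OF zv] Lp[OF z] derivative_in_Lp[OF z r] p_pos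
    by (simp add: Lp_diff_class Lp_fun_diff)
  then show ?thesis
    using remainder_seminorm[OF z r v] by (simp add: Lp_norm_class[OF remainder_in_Lp[OF z r v]])
qed

lemma holomorphic_Lp_family: "holomorphic_Lp M p (\<lambda>z. Lp_class M p (f z)) U"
  unfolding holomorphic_Lp_def
proof (intro conjI ballI)
  fix z assume z: "z \<in> U"
  show "Lp_class M p (f z) \<in> Lp M p"
    by (rule Lp_class_in_Lp[OF Lp[OF z]])
  obtain r where r: "0 < r" "ball z r \<subseteq> U"
    using U(1) z open_contains_ball by blast
  define D where "D v = Lp_class M p (\<lambda>t. cD (\<lambda>w. f w t) z v)" for v
  note mem = derivative_in_Lp[OF z r]
  have "Lp_linear M p D"
    unfolding Lp_linear_def
  proof (intro conjI allI)
    show "D v \<in> Lp M p" for v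
      unfolding D_def by (rule Lp_class_in_Lp[OF mem])
    show "D (v + w) = Lp_add M p (D v) (D w)" for v w
      unfolding D_def Lp_add_class[OF p_pos mem mem]
      by (subst Lp_class_eq_iff[OF mem Lp_fun_add[OF p_pos mem mem]])
        (auto intro!: AE_I2 simp: cD_add[OF holomorphic z])
    show "D (c *s v) = Lp_scale M p c (D v)" for c v
      unfolding D_def Lp_scale_class[OF mem]
      by (subst Lp_class_eq_iff[OF mem Lp_fun_scale[OF mem]])
        (auto intro!: AE_I2 simp: cD_scale[OF holomorphic z])
  qed
  moreover have "\<exists>C. \<forall>v. Lp_norm M p (D v) \<le> C * norm v"
    using derivative_seminorm[OF z r]
    by (intro exI[of _ "2 * K / r"] allI) (simp only: D_def Lp_norm_class[OF mem])
  moreover have "((\<lambda>v. Lp_norm M p (Lp_diff M p (Lp_diff M p (Lp_class M p (f (z + v))) (Lp_class M p (f z))) (D v))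
      / norm v) \<longlongrightarrow> 0) (at 0)"
  proof (rule Lim_null_comparison)
    have "\<forall>\<^sub>F v in at (0 :: complex ^ 'd). norm v < r / 2 \<and> v \<noteq> 0"
      using r(1) by (auto simp: eventually_at intro!: exI[of _ "r / 2"])
    then show "\<forall>\<^sub>F v in at 0. norm (Lp_norm M p (Lp_diff M p (Lp_diff M p (Lp_class M p (f (z + v)))
        (Lp_class M p (f z))) (D v)) / norm v) \<le> 8 * K / r\<^sup>2 * norm v"
    proof eventually_elim
      case (elim v)
      then show ?case
        using Lp_class_remainder[OF z r, of v]
        by (simp add: D_def Lp_norm_def field_simps power2_eq_square)
    qed
    show "((\<lambda>v. 8 * K / r\<^sup>2 * norm v) \<longlongrightarrow> 0) (at (0 :: complex ^ 'd))"
      by (intro tendsto_mult_right_zero tendsto_norm_zero tendsto_ident_at)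
  qed
  ultimately show "\<exists>D. Lp_linear M p D \<and> (\<exists>K. \<forall>v. Lp_norm M p (D v) \<le> K * norm v) \<and>
      ((\<lambda>v. Lp_norm M p (Lp_diff M p (Lp_diff M p (Lp_class M p (f (z + v))) (Lp_class M p (f z))) (D v))
        / norm v) \<longlongrightarrow> 0) (at 0)"
    by blast
qed

lemma Lp_partial_class:
  assumes z: "z \<in> U"
  shows "Lp_partial M p j (\<lambda>z. Lp_class M p (f z)) z = Lp_class M p (\<lambda>t. cpartial j (\<lambda>w. f w t) z)"
proof -
  obtain r where r: "0 < r" "ball z r \<subseteq> U"
    using U(1) z open_contains_ball by blast
  define d where "d t = cD (\<lambda>w. f w t) z (axis j 1)" for t
  have d: "d \<in> Lp_fun M p"
    unfolding d_def by (rule derivative_in_Lp[OF z r])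
  define q where "q s t = inverse s * (f (z + axis j s) t - f z t)" for s t
  have near: "\<forall>\<^sub>F s in at (0::complex). norm s < r / 2 \<and> s \<noteq> 0"
    using r(1) by (auto simp: eventually_at intro!: exI[of _ "r / 2"])
  have q: "q s \<in> Lp_fun M p"
    and q_class: "Lp_scale M p (inverse s) (Lp_diff M p (Lp_class M p (f (z + axis j s))) (Lp_class M p (f z)))
      = Lp_class M p (q s)"
    and q_near: "Lp_seminorm M p (\<lambda>t. q s t - d t) \<le> 8 * K / r\<^sup>2 * norm s"
    if s: "norm s < r / 2" "s \<noteq> 0" for s
  proof -
    have zs: "z + axis j s \<in> U"
      using s r by (auto simp: subset_iff dist_norm norm_axis_complex)
    have diff: "(\<lambda>t. f (z + axis j s) t - f z t) \<in> Lp_fun M p"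
      by (intro Lp_fun_diff p_pos Lp z zs)
    then show "q s \<in> Lp_fun M p"
      unfolding q_def by (rule Lp_fun_scale)
    show "Lp_scale M p (inverse s) (Lp_diff M p (Lp_class M p (f (z + axis j s))) (Lp_class M p (f z)))
      = Lp_class M p (q s)"
      unfolding q_def by (simp add: Lp_diff_class[OF p_pos Lp[OF zs] Lp[OF z]] Lp_scale_class[OF diff])
    have "Lp_seminorm M p (\<lambda>t. q s t - d t)
      = Lp_seminorm M p (\<lambda>t. inverse s * (f (z + axis j s) t - f z t - cD (\<lambda>w. f w t) z (axis j s)))"
    proof (rule Lp_seminorm_cong)
      fix t assume t: "t \<in> space M"
      have "cD (\<lambda>w. f w t) z (axis j s) = s * d t"
        using cD_scale[OF holomorphic[OF t] z, of s "axis j 1"] by (simp add: d_def axis_eq_scale[of j s])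
      then show "q s t - d t = inverse s * (f (z + axis j s) t - f z t - cD (\<lambda>w. f w t) z (axis j s))"
        using s(2) by (simp add: q_def algebra_simps)
    qed
    also have "\<dots> \<le> norm (inverse s) * (8 * K / r\<^sup>2 * (norm s)\<^sup>2)"
      unfolding Lp_seminorm_scale[OF p_pos] using remainder_seminorm[OF z r, of "axis j s"] s(1)
      by (intro mult_left_mono) (auto simp: norm_axis_complex)
    also have "\<dots> = 8 * K / r\<^sup>2 * norm s"
      using s(2) by (simp add: norm_inverse power2_eq_square)
    finally show "Lp_seminorm M p (\<lambda>t. q s t - d t) \<le> 8 * K / r\<^sup>2 * norm s" .
  qed
  have limit_iff: "((\<lambda>s. Lp_norm M p (Lp_diff M p (Lp_scale M p (inverse s)
        (Lp_diff M p (Lp_class M p (f (z + axis j s))) (Lp_class M p (f z)))) (Lp_class M p u))) \<longlongrightarrow> 0) (at 0)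
      \<longleftrightarrow> ((\<lambda>s. Lp_seminorm M p (\<lambda>t. q s t - u t)) \<longlongrightarrow> 0) (at 0)" if u: "u \<in> Lp_fun M p" for u
  proof (rule filterlim_cong[OF refl refl])
    show "\<forall>\<^sub>F s in at 0. Lp_norm M p (Lp_diff M p (Lp_scale M p (inverse s)
        (Lp_diff M p (Lp_class M p (f (z + axis j s))) (Lp_class M p (f z)))) (Lp_class M p u))
      = Lp_seminorm M p (\<lambda>t. q s t - u t)"
      using near
    proof eventually_elim
      case (elim s)
      then have s: "norm s < r / 2" "s \<noteq> 0" by auto
      show ?case
        unfolding q_class[OF s] Lp_diff_class[OF p_pos q[OF s] u]
          Lp_norm_class[OF Lp_fun_diff[OF p_pos q[OF s] u]] ..
    qed
  qed
  have d_lim: "((\<lambda>s. Lp_seminorm M p (\<lambda>t. q s t - d t)) \<longlongrightarrow> 0) (at 0)"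
  proof (rule Lim_null_comparison)
    show "\<forall>\<^sub>F s in at 0. norm (Lp_seminorm M p (\<lambda>t. q s t - d t)) \<le> 8 * K / r\<^sup>2 * norm s"
      using near
    proof eventually_elim
      case (elim s)
      then show ?case
        using q_near[of s] by auto
    qed
    show "((\<lambda>s. 8 * K / r\<^sup>2 * norm s) \<longlongrightarrow> 0) (at (0 :: complex))"
      by (intro tendsto_mult_right_zero tendsto_norm_zero tendsto_ident_at)
  qed
  have "Lp_partial M p j (\<lambda>z. Lp_class M p (f z)) z = Lp_class M p d"
    unfolding Lp_partial_def
  proof (rule the_equality, intro conjI)
    show "Lp_class M p d \<in> Lp M p"
      by (rule Lp_class_in_Lp[OF d])
    show "((\<lambda>s. Lp_norm M p (Lp_diff M p (Lp_scale M p (inverse s)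
        (Lp_diff M p (Lp_class M p (f (z + axis j s))) (Lp_class M p (f z)))) (Lp_class M p d))) \<longlongrightarrow> 0) (at 0)"
      unfolding limit_iff[OF d] by (rule d_lim)
  next
    fix A assume A: "A \<in> Lp M p \<and> ((\<lambda>s. Lp_norm M p (Lp_diff M p (Lp_scale M p (inverse s)
        (Lp_diff M p (Lp_class M p (f (z + axis j s))) (Lp_class M p (f z)))) A)) \<longlongrightarrow> 0) (at 0)"
    then obtain u where u: "u \<in> Lp_fun M p" "A = Lp_class M p u"
      by (auto simp: Lp_def Lp_class_def elim: quotientE)
    have u_lim: "((\<lambda>s. Lp_seminorm M p (\<lambda>t. q s t - u t)) \<longlongrightarrow> 0) (at 0)"
      using A limit_iff[OF u(1)] by (simp add: u(2))
    \<comment> \<open>The triangle inequality makes the limit of the difference quotients unique.\<close>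
    have "Lp_seminorm M p (\<lambda>t. u t - d t) \<le> 0"
    proof (rule tendsto_lowerbound)
      show "((\<lambda>s. Lp_seminorm M p (\<lambda>t. q s t - u t) + Lp_seminorm M p (\<lambda>t. q s t - d t)) \<longlongrightarrow> 0) (at 0)"
        using tendsto_add[OF u_lim d_lim] by simp
      show "\<forall>\<^sub>F s in at 0. Lp_seminorm M p (\<lambda>t. u t - d t)
          \<le> Lp_seminorm M p (\<lambda>t. q s t - u t) + Lp_seminorm M p (\<lambda>t. q s t - d t)"
        using near
      proof eventually_elim
        case (elim s)
        then have qs: "q s \<in> Lp_fun M p"
          using q by blast
        have "Lp_seminorm M p (\<lambda>t. u t - d t) = Lp_seminorm M p (\<lambda>t. (u t - q s t) + (q s t - d t))"
          by simp
        also have "\<dots> \<le> Lp_seminorm M p (\<lambda>t. u t - q s t) + Lp_seminorm M p (\<lambda>t. q s t - d t)"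
          by (intro Lp_seminorm_triangle p Lp_fun_diff p_pos qs u d)
        also have "Lp_seminorm M p (\<lambda>t. u t - q s t) = Lp_seminorm M p (\<lambda>t. q s t - u t)"
          by (simp add: Lp_seminorm_def norm_minus_commute)
        finally show ?case .
      qed
    qed simp
    then have "Lp_seminorm M p (\<lambda>t. u t - d t) = 0"
      using Lp_seminorm_nonneg[of M p "\<lambda>t. u t - d t"] by linarith
    then have "AE t in M. u t - d t = 0"
      by (intro Lp_seminorm_eq_0D[OF p_pos Lp_fun_diff[OF p_pos u(1) d]])
    then show "A = Lp_class M p d"
      unfolding u(2) Lp_class_eq_iff[OF u(1) d] by eventually_elim simp
  qed
  also have "\<dots> = Lp_class M p (\<lambda>t. cpartial j (\<lambda>w. f w t) z)"
  proof (subst Lp_class_eq_iff)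
    show "d \<in> Lp_fun M p" by (rule d)
    have eq: "d t = cpartial j (\<lambda>w. f w t) z" if "t \<in> space M" for t
      by (simp add: d_def cpartial_eq_cD[OF holomorphic[OF that] z])
    then show "(\<lambda>t. cpartial j (\<lambda>w. f w t) z) \<in> Lp_fun M p"
      using Lp_fun_cong[of M d "\<lambda>t. cpartial j (\<lambda>w. f w t) z" p] d by blast
    show "AE t in M. d t = cpartial j (\<lambda>w. f w t) z"
      by (rule AE_I2) (rule eq)
  qed
  finally show ?thesis .
qed

lemma cpartial_pairing:
  assumes z: "z \<in> U" and h: "dual_fun M p N h"
  shows "cpartial j (\<lambda>w. \<integral>t. f w t * h t \<partial>M) z = (\<integral>t. cpartial j (\<lambda>w. f w t) z * h t \<partial>M)"
proof -
  have "cpartial j (\<lambda>w. \<integral>t. f w t * h t \<partial>M) z = (\<integral>t. cD (\<lambda>w. f w t) z (axis j 1) * h t \<partial>M)"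
    unfolding derivative_pairing[OF z h] by (rule cpartial_eq_cD[OF pairing_holomorphic[OF h] z])
  also have "\<dots> = (\<integral>t. cpartial j (\<lambda>w. f w t) z * h t \<partial>M)"
    by (intro Bochner_Integration.integral_cong) (simp_all add: cpartial_eq_cD[OF holomorphic z])
  finally show ?thesis .
qed

lemma cpartial_family:
  assumes z: "z \<in> U"
  obtains V K' where "z \<in> V" "V \<subseteq> U" "Lp_family M p V (\<lambda>w t. cpartial j (\<lambda>w. f w t) w) K'"
proof -
  obtain r where r: "0 < r" "ball z r \<subseteq> U"
    using U(1) z open_contains_ball by blast
  define V where "V = ball z (r / 2)"
  have sub: "ball w (r / 2) \<subseteq> U" if "w \<in> V" for w
  proof
    fix y assume "y \<in> ball w (r / 2)"
    then have "y \<in> ball z r"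
      using that dist_triangle[of z y w] by (simp add: V_def)
    then show "y \<in> U"
      using r(2) by blast
  qed
  have VU: "V \<subseteq> U"
    using r by (auto simp: V_def)
  have "Lp_family M p V (\<lambda>w t. cpartial j (\<lambda>w. f w t) w) (2 * K / (r / 2) * 1)"
  proof
    show "1 \<le> p" by (rule p)
    show "open V" "V \<noteq> {}"
      using r(1) by (auto simp: V_def)
    fix w assume w: "w \<in> V"
    then have wU: "w \<in> U"
      using VU by blast
    have eq: "cpartial j (\<lambda>w. f w t) w = cD (\<lambda>w. f w t) w (axis j 1)" if "t \<in> space M" for t
      by (rule cpartial_eq_cD[OF holomorphic[OF that] wU])
    have r2: "0 < r / 2"
      using r(1) by simp
    show "(\<lambda>t. cpartial j (\<lambda>w. f w t) w) \<in> Lp_fun M p"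
      using Lp_fun_cong[of M "\<lambda>t. cpartial j (\<lambda>w. f w t) w" "\<lambda>t. cD (\<lambda>w. f w t) w (axis j 1)" p, OF eq]
        derivative_in_Lp[OF wU r2 sub[OF w]] by simp
    show "Lp_seminorm M p (\<lambda>t. cpartial j (\<lambda>w. f w t) w) \<le> 2 * K / (r / 2) * 1"
      using Lp_seminorm_cong[of M "\<lambda>t. cpartial j (\<lambda>w. f w t) w" "\<lambda>t. cD (\<lambda>w. f w t) w (axis j 1)" p, OF eq]
         derivative_seminorm[OF wU r2 sub[OF w], of "axis j 1"] by (simp only: norm_axis_complex norm_one)
  next
    fix t assume t: "t \<in> space M"
    obtain b where b: "\<And>z. z \<in> U \<Longrightarrow> norm (f z t) \<le> b"
      using Hinf_obtain_bound[OF Hinf[OF t]] by metis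
    have "open V" "0 < r / 2"
      using r(1) by (auto simp: V_def)
    note * = cpartial_Hinf[OF U(1) this sub holomorphic[OF t] b, where j = j]
    show "(\<lambda>w. cpartial j (\<lambda>w. f w t) w) \<in> Hinf V"
      by (rule HinfI[OF *(1,2)])
  qed
  then show ?thesis
    using that[of V] VU r(1) by (simp add: V_def)
qed

end

section \<open>Iterated partial derivatives\<close>

text \<open>This serves to compare the iterates of different derivative operators: on \<open>L\<^sub>p\<close>-valued maps, on scalar functions and on families.\<close>

lemma iterate_partials_rel:
  assumes base: "R G H" and step: "\<And>j G H. R G H \<Longrightarrow> R (P j G) (Q j H)"
  shows "R (iterate_partials P \<alpha> G) (iterate_partials Q \<alpha> H)"
proof -
  have pow: "R ((P j ^^ n) G) ((Q j ^^ n) H)" if "R G H" for j n G H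
    using that by (induction n) (auto intro: step)
  have "R (foldr (\<lambda>j H. (P j ^^ \<alpha> j) H) js G) (foldr (\<lambda>j H. (Q j ^^ \<alpha> j) H) js H)" for js
    using base by (induction js) (auto intro: pow)
  then show ?thesis
    unfolding iterate_partials_def .
qed

definition family_partial ::
    "'d \<Rightarrow> (complex ^ 'd \<Rightarrow> 'a \<Rightarrow> complex) \<Rightarrow> complex ^ 'd \<Rightarrow> 'a \<Rightarrow> complex" where
  "family_partial j f = (\<lambda>z t. cpartial j (\<lambda>w. f w t) z)"

lemma iterate_family_partial:
  "iterate_partials family_partial \<alpha> f z t = cpartials \<alpha> (\<lambda>w. f w t) z"
proof -
  have "(\<lambda>G H. H = (\<lambda>w. G w t)) (iterate_partials family_partial \<alpha> f) (iterate_partials cpartial \<alpha> (\<lambda>w. f w t))"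
    by (rule iterate_partials_rel[where R = "\<lambda>G H. H = (\<lambda>w. G w t)"]) (auto simp: family_partial_def)
  then show ?thesis
    by (simp add: cpartials_def)
qed

text \<open>Derivatives of a bounded holomorphic function are bounded only away from the boundary of its domain.  The
class of families that is stable under differentiation is therefore the local one.\<close>

definition local_Lp_family ::
    "'a measure \<Rightarrow> real \<Rightarrow> (complex ^ 'd) set \<Rightarrow> (complex ^ 'd \<Rightarrow> 'a \<Rightarrow> complex) \<Rightarrow> bool" where
  "local_Lp_family M p U f \<longleftrightarrow> (\<forall>z\<in>U. \<exists>V K. z \<in> V \<and> V \<subseteq> U \<and> Lp_family M p V f K)"

lemma local_Lp_family_partial:
  assumes "local_Lp_family M p U f"
  shows "local_Lp_family M p U (family_partial j f)"
  unfolding local_Lp_family_def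
proof
  fix z assume "z \<in> U"
  then obtain V K where V: "z \<in> V" "V \<subseteq> U" "Lp_family M p V f K"
    using assms by (auto simp: local_Lp_family_def)
  obtain W K' where "z \<in> W" "W \<subseteq> V" "Lp_family M p W (\<lambda>w t. cpartial j (\<lambda>w. f w t) w) K'"
    using Lp_family.cpartial_family[OF V(3,1)] by metis
  then show "\<exists>V K. z \<in> V \<and> V \<subseteq> U \<and> Lp_family M p V (family_partial j f) K"
    using V(2) unfolding family_partial_def by blast
qed

lemma eventually_shift_in_open:
  fixes z :: "complex ^ 'd"
  assumes "open V" "z \<in> V"
  shows "\<forall>\<^sub>F s in nhds 0. z + axis j s \<in> V"
proof -
  obtain r where r: "0 < r" "ball z r \<subseteq> V"
    using assms open_contains_ball by blast
  then have "z + axis j s \<in> V" if "dist s 0 < r" for s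
    using that by (auto simp: subset_iff dist_norm norm_axis_complex)
  then show ?thesis
    using r(1) unfolding eventually_nhds_metric by blast
qed

lemma cpartial_local:
  assumes V: "open V" "z \<in> V" and eq: "\<And>w. w \<in> V \<Longrightarrow> g w = g' w"
  shows "cpartial j g z = cpartial j g' z"
  unfolding cpartial_def
proof (rule deriv_cong_ev[OF _ refl])
  show "\<forall>\<^sub>F s in nhds 0. g (z + axis j s) = g' (z + axis j s)"
    using eventually_shift_in_open[OF V] by eventually_elim (rule eq)
qed

lemma Lp_partial_local:
  assumes V: "open V" "z \<in> V" and eq: "\<And>w. w \<in> V \<Longrightarrow> G w = G' w"
  shows "Lp_partial M p j G z = Lp_partial M p j G' z"
proof -
  have "\<forall>\<^sub>F s in at 0. G (z + axis j s) = G' (z + axis j s)"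
    using eventually_shift_in_open[OF V, of j] unfolding eventually_at_filter
    by eventually_elim (use eq in blast)
  note near = this
  have "((\<lambda>s. Lp_norm M p (Lp_diff M p (Lp_scale M p (inverse s) (Lp_diff M p (G (z + axis j s)) (G z))) A)) \<longlongrightarrow> 0) (at 0)
    \<longleftrightarrow> ((\<lambda>s. Lp_norm M p (Lp_diff M p (Lp_scale M p (inverse s) (Lp_diff M p (G' (z + axis j s)) (G' z))) A)) \<longlongrightarrow> 0) (at 0)" for A
  proof (rule filterlim_cong[OF refl refl])
    show "\<forall>\<^sub>F s in at 0.
        Lp_norm M p (Lp_diff M p (Lp_scale M p (inverse s) (Lp_diff M p (G (z + axis j s)) (G z))) A)
        = Lp_norm M p (Lp_diff M p (Lp_scale M p (inverse s) (Lp_diff M p (G' (z + axis j s)) (G' z))) A)"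
      using near by eventually_elim (simp add: eq[OF V(2)])
  qed
  then show ?thesis
    unfolding Lp_partial_def by simp
qed

text \<open>Partial derivatives depend only on the values near the point, so that in every step the map may be replaced by
a family that is bounded near that point.\<close>

lemma Lp_partials_local_family:
  fixes f :: "(complex, 'd::{finite,linorder}) vec \<Rightarrow> 'a \<Rightarrow> complex"
  assumes f: "local_Lp_family M p U f"
  shows "local_Lp_family M p U (iterate_partials family_partial \<alpha> f) \<and>
    (\<forall>z\<in>U. Lp_partials M p \<alpha> (\<lambda>z. Lp_class M p (f z)) z
      = Lp_class M p (iterate_partials family_partial \<alpha> f z))"
  unfolding Lp_partials_def
proof (rule iterate_partials_rel[where
      R = "\<lambda>G f. local_Lp_family M p U f \<and> (\<forall>z\<in>U. G z = Lp_class M p (f z))"])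
  fix j G and f :: "(complex, 'd) vec \<Rightarrow> 'a \<Rightarrow> complex"
  assume asm: "local_Lp_family M p U f \<and> (\<forall>z\<in>U. G z = Lp_class M p (f z))"
  have "Lp_partial M p j G z = Lp_class M p (family_partial j f z)" if z: "z \<in> U" for z
  proof -
    obtain V K where V: "z \<in> V" "V \<subseteq> U" "Lp_family M p V f K"
      using asm z by (auto simp: local_Lp_family_def)
    have "Lp_partial M p j G z = Lp_partial M p j (\<lambda>z. Lp_class M p (f z)) z"
      using asm V(2) by (intro Lp_partial_local[OF Lp_family.U(1)[OF V(3)] V(1)]) blast
    then show ?thesis
      using Lp_family.Lp_partial_class[OF V(3,1)] by (simp add: family_partial_def)
  qed
  then show "local_Lp_family M p U (family_partial j f) \<and>
      (\<forall>z\<in>U. Lp_partial M p j G z = Lp_class M p (family_partial j f z))"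
    using asm local_Lp_family_partial by blast
qed (use f in auto)

lemma cpartials_pairing_local_family:
  fixes f :: "(complex, 'd::{finite,linorder}) vec \<Rightarrow> 'a \<Rightarrow> complex"
  assumes f: "local_Lp_family M p U f" and h: "dual_fun M p N h"
  shows "local_Lp_family M p U (iterate_partials family_partial \<alpha> f) \<and>
    (\<forall>z\<in>U. cpartials \<alpha> (\<lambda>z. \<integral>t. f z t * h t \<partial>M) z
      = (\<integral>t. iterate_partials family_partial \<alpha> f z t * h t \<partial>M))"
  unfolding cpartials_def
proof (rule iterate_partials_rel[where
      R = "\<lambda>g f. local_Lp_family M p U f \<and> (\<forall>z\<in>U. g z = (\<integral>t. f z t * h t \<partial>M))"])
  fix j g and f :: "(complex, 'd) vec \<Rightarrow> 'a \<Rightarrow> complex"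
  assume asm: "local_Lp_family M p U f \<and> (\<forall>z\<in>U. g z = (\<integral>t. f z t * h t \<partial>M))"
  have "cpartial j g z = (\<integral>t. family_partial j f z t * h t \<partial>M)" if z: "z \<in> U" for z
  proof -
    obtain V K where V: "z \<in> V" "V \<subseteq> U" "Lp_family M p V f K"
      using asm z by (auto simp: local_Lp_family_def)
    have "cpartial j g z = cpartial j (\<lambda>z. \<integral>t. f z t * h t \<partial>M) z"
      using asm V(2) by (intro cpartial_local[OF Lp_family.U(1)[OF V(3)] V(1)]) blast
    then show ?thesis
      using Lp_family.cpartial_pairing[OF V(3,1) h] by (simp add: family_partial_def)
  qed
  then show "local_Lp_family M p U (family_partial j f) \<and>
      (\<forall>z\<in>U. cpartial j g z = (\<integral>t. family_partial j f z t * h t \<partial>M))"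
    using asm local_Lp_family_partial by blast
qed (use f in auto)

section \<open>The closed span and the norm of a functional\<close>

lemma (in Lp_family) finite_combination_in_span:
  fixes N :: nat
  assumes V: "Lp_subspace M p V" "(\<lambda>z. Lp_class M p (f z)) ` U \<subseteq> V" and x: "\<And>k. x k \<in> U"
  shows "Lp_class M p (\<lambda>t. \<Sum>k<N. c k * f (x k) t) \<in> V"
proof (induct N)
  case 0
  then show ?case
    using V(1) by (simp add: Lp_subspace_def)
next
  case (Suc N)
  have "Lp_class M p (f (x N)) \<in> V"
    using V(2) x by blast
  then have "Lp_scale M p (c N) (Lp_class M p (f (x N))) \<in> V"
    using V(1) by (simp add: Lp_subspace_def)
  then have "Lp_class M p (\<lambda>t. c N * f (x N) t) \<in> V"
    by (simp add: Lp_scale_class[OF Lp[OF x]])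
  then have "Lp_add M p (Lp_class M p (\<lambda>t. \<Sum>k<N. c k * f (x k) t)) (Lp_class M p (\<lambda>t. c N * f (x N) t)) \<in> V"
    using V(1) Suc by (simp add: Lp_subspace_def)
  then show ?case
    using Lp_add_class[OF p_pos Lp_fun_sum[OF p_pos Lp[OF x]] Lp_fun_scale[OF Lp[OF x]]] by simp
qed

lemma (in Lp_family) functional_in_closed_span:
  assumes lin: "Hinf_linear U \<psi>" and bp: "bp_continuous U \<psi>"
  shows "Lp_class M p (\<lambda>t. \<psi> (\<lambda>z. f z t)) \<in> Lp_closed_span M p ((\<lambda>z. Lp_class M p (f z)) ` U)"
proof -
  obtain A where A: "\<And>g. g \<in> Hinf_unit_ball U \<Longrightarrow> norm (\<psi> g) \<le> A"
    using bp_continuous_bounded[OF lin bp] by metis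
  have mem: "(\<lambda>t. \<psi> (\<lambda>z. f z t)) \<in> Lp_fun M p"
    by (rule functional_Lp[OF lin bp A])
  have "\<exists>B \<in> Lp_subspace M p hull ((\<lambda>z. Lp_class M p (f z)) ` U).
      Lp_norm M p (Lp_diff M p (Lp_class M p (\<lambda>t. \<psi> (\<lambda>z. f z t))) B) < \<epsilon>" if \<epsilon>: "0 < \<epsilon>" for \<epsilon>
  proof -
    obtain x c and N :: nat where x: "\<And>k. x k \<in> U"
      and close: "Lp_seminorm M p (\<lambda>t. \<psi> (\<lambda>z. f z t) - (\<Sum>k<N. c k * f (x k) t)) < \<epsilon>"
      using functional_approx[OF lin bp A \<epsilon>] by blast
    have sum: "(\<lambda>t. \<Sum>k<N. c k * f (x k) t) \<in> Lp_fun M p"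
      by (intro Lp_fun_sum p_pos Lp x)
    show ?thesis
    proof
      show "Lp_class M p (\<lambda>t. \<Sum>k<N. c k * f (x k) t)
          \<in> Lp_subspace M p hull ((\<lambda>z. Lp_class M p (f z)) ` U)"
        unfolding hull_def
      proof (rule InterI)
        fix V assume "V \<in> {V. Lp_subspace M p V \<and> (\<lambda>z. Lp_class M p (f z)) ` U \<subseteq> V}"
        then show "Lp_class M p (\<lambda>t. \<Sum>k<N. c k * f (x k) t) \<in> V"
          by (intro finite_combination_in_span x) simp_all
      qed
      show "Lp_norm M p (Lp_diff M p (Lp_class M p (\<lambda>t. \<psi> (\<lambda>z. f z t)))
          (Lp_class M p (\<lambda>t. \<Sum>k<N. c k * f (x k) t))) < \<epsilon>"
        using close by (simp add: Lp_diff_class[OF p_pos mem sum] Lp_norm_class[OF Lp_fun_diff[OF p_pos mem sum]])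
    qed
  qed
  then show ?thesis
    unfolding Lp_closed_span_def using Lp_class_in_Lp[OF mem] by blast
qed

text \<open>The supremum that defines the norm of \<open>\<phi>\<close> is a supremum of a bounded set, because \<open>\<phi>\<close> is bounded on the unit
ball; otherwise its value would be arbitrary.\<close>

lemma functional_le_norm:
  assumes U: "U \<noteq> {}" and lin: "Hinf_linear U \<phi>" and bp: "bp_continuous U \<phi>"
    and g: "g \<in> Hinf_unit_ball U"
  shows "norm (\<phi> g) \<le> Hinf_functional_norm U \<phi>"
proof -
  have "{g \<in> Hinf U. sup_norm U g \<le> 1} = Hinf_unit_ball U"
  proof (intro equalityI subsetI)
    fix g assume g: "g \<in> {g \<in> Hinf U. sup_norm U g \<le> 1}"
    have "norm (g z) \<le> 1" if "z \<in> U" for z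
    proof -
      obtain B where "\<And>z. z \<in> U \<Longrightarrow> norm (g z) \<le> B"
        using Hinf_obtain_bound[of g U] g by auto
      then have "bdd_above ((\<lambda>z. norm (g z)) ` U)"
        by (auto intro!: bdd_aboveI)
      then have "norm (g z) \<le> sup_norm U g"
        unfolding sup_norm_def using that by (rule cSUP_upper[rotated])
      then show ?thesis
        using g by simp
    qed
    then show "g \<in> Hinf_unit_ball U"
      using g by (simp add: Hinf_unit_ball_def)
  next
    fix g assume "g \<in> Hinf_unit_ball U"
    then show "g \<in> {g \<in> Hinf U. sup_norm U g \<le> 1}"
      unfolding sup_norm_def Hinf_unit_ball_def using U by (auto intro!: cSUP_least)
  qed
  moreover obtain A where "\<And>g. g \<in> Hinf_unit_ball U \<Longrightarrow> norm (\<phi> g) \<le> A"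
    using bp_continuous_bounded[OF lin bp] by metis
  then have "bdd_above ((\<lambda>g. norm (\<phi> g)) ` Hinf_unit_ball U)"
    by (auto intro!: bdd_aboveI)
  ultimately show ?thesis
    unfolding Hinf_functional_norm_def using cSUP_upper[OF g] by metis
qed

section \<open>Holomorphic dependence on a parameter in \<open>L\<^sub>p\<close>\<close>

lemma Lp_familyI:
  assumes p: "1 \<le> p" and U: "open U" "U \<noteq> {}"
    and meas: "\<And>z. z \<in> U \<Longrightarrow> f z \<in> borel_measurable M"
    and sup: "(SUP z\<in>U. \<integral>\<^sup>+ t. ennreal (norm (f z t) powr p) \<partial>M) < \<infinity>"
    and Hinf: "\<And>t. t \<in> space M \<Longrightarrow> (\<lambda>z. f z t) \<in> Hinf U"
  shows "bdd_above ((\<lambda>z. Lp_norm M p (Lp_class M p (f z))) ` U)"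
    and "Lp_family M p U f (SUP z\<in>U. Lp_norm M p (Lp_class M p (f z)))"
proof -
  define S where "S = enn2real (SUP z\<in>U. \<integral>\<^sup>+ t. ennreal (norm (f z t) powr p) \<partial>M)"
  have le: "(\<integral>\<^sup>+ t. ennreal (norm (f z t) powr p) \<partial>M) \<le> ennreal S" if "z \<in> U" for z
    using SUP_upper[OF that, of "\<lambda>z. \<integral>\<^sup>+ t. ennreal (norm (f z t) powr p) \<partial>M"] sup
    by (simp add: S_def)
  have Lp: "f z \<in> Lp_fun M p" if z: "z \<in> U" for z
  proof -
    have [measurable]: "f z \<in> borel_measurable M"
      by (rule meas[OF z])
    have "integrable M (\<lambda>t. norm (f z t) powr p)"
    proof (rule integrableI_bounded)
      show "(\<integral>\<^sup>+t. ennreal (norm (norm (f z t) powr p)) \<partial>M) < \<infinity>"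
        using le_less_trans[OF le[OF z] ennreal_less_top] by simp
    qed measurable
    then show ?thesis
      by (simp add: Lp_fun_def)
  qed
  have "Lp_seminorm M p (f z) \<le> S powr (1 / p)" if z: "z \<in> U" for z
  proof -
    have int: "integrable M (\<lambda>t. norm (f z t) powr p)"
      using Lp[OF z] by (simp add: Lp_fun_def)
    have "ennreal (\<integral>t. norm (f z t) powr p \<partial>M) \<le> ennreal S"
      using le[OF z] by (simp add: nn_integral_eq_integral[OF int])
    then have "(\<integral>t. norm (f z t) powr p \<partial>M) \<le> S"
      by (subst (asm) ennreal_le_iff) (simp_all add: S_def)
    then show ?thesis
      unfolding Lp_seminorm_def using p by (intro powr_mono2) auto
  qed
  then show bdd: "bdd_above ((\<lambda>z. Lp_norm M p (Lp_class M p (f z))) ` U)"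
    by (intro bdd_aboveI[of _ "S powr (1 / p)"]) (auto simp: Lp_norm_class[OF Lp])
  show "Lp_family M p U f (SUP z\<in>U. Lp_norm M p (Lp_class M p (f z)))"
  proof
    show "Lp_seminorm M p (f z) \<le> (SUP z\<in>U. Lp_norm M p (Lp_class M p (f z)))" if "z \<in> U" for z
      using cSUP_upper[OF that bdd] by (simp add: Lp_norm_class[OF Lp[OF that]])
  qed (use assms Lp in auto)
qed

theorem theorem4p3:
  fixes M :: "'a measure" and p :: real and q :: ennreal
    and U :: "(complex ^ 'd::{finite,linorder}) set"
    and f :: "complex ^ 'd::{finite,linorder} \<Rightarrow> 'a \<Rightarrow> complex"
    and \<alpha> :: "'d::{finite,linorder} \<Rightarrow> nat" and a :: "complex ^ 'd::{finite,linorder}"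
    and \<phi> :: "(complex ^ 'd::{finite,linorder} \<Rightarrow> complex) \<Rightarrow> complex"
  assumes "1 \<le> p" and "1 / ennreal p + 1 / q = 1"
    and "open U" and "U \<noteq> {}"
    and "\<And>z. z \<in> U \<Longrightarrow> f z \<in> borel_measurable M"
    and "(SUP z\<in>U. \<integral>\<^sup>+ t. ennreal (norm (f z t) powr p) \<partial>M) < \<infinity>"
    and "\<And>t. t \<in> space M \<Longrightarrow> (\<lambda>z. f z t) \<in> Hinf U"
    and "a \<in> U"
    and "Hinf_linear U \<phi>" and "bp_continuous U \<phi>"
  shows "let F = (\<lambda>z. Lp_class M p (f z)) in
    (F \<in> Hinf_Lp M p U \<and>
     Lp_partials M p \<alpha> F a \<in> Lp M p \<and>
     (\<lambda>t. cpartials \<alpha> (\<lambda>z. f z t) a) \<in> Lp_partials M p \<alpha> F a)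
    \<and>
    (\<forall>h \<in> Lq_fun M q.
       (\<forall>z\<in>U. integrable M (\<lambda>t. f z t * h t)) \<and>
       holomorphic_vec (\<lambda>z. \<integral>t. f z t * h t \<partial>M) U \<and>
       (\<forall>z\<in>U. integrable M (\<lambda>t. cpartials \<alpha> (\<lambda>w. f w t) z * h t) \<and>
          cpartials \<alpha> (\<lambda>w. \<integral>t. f w t * h t \<partial>M) z
            = (\<integral>t. cpartials \<alpha> (\<lambda>w. f w t) z * h t \<partial>M)))
    \<and>
    ((\<lambda>t. \<phi> (\<lambda>z. f z t)) \<in> Lp_fun M p \<and>
     (\<integral>t. norm (\<phi> (\<lambda>z. f z t)) powr p \<partial>M) powr (1 / p)
       \<le> Hinf_functional_norm U \<phi> * (SUP z\<in>U. Lp_norm M p (F z)) \<and>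
     Lp_class M p (\<lambda>t. \<phi> (\<lambda>z. f z t)) \<in> Lp_closed_span M p (F ` U))
    \<and>
    (\<forall>h \<in> Lq_fun M q.
       integrable M (\<lambda>t. \<phi> (\<lambda>z. f z t) * h t) \<and>
       (\<lambda>z. \<integral>t. f z t * h t \<partial>M) \<in> Hinf U \<and>
       (\<integral>t. \<phi> (\<lambda>z. f z t) * h t \<partial>M) = \<phi> (\<lambda>z. \<integral>t. f z t * h t \<partial>M))"
proof -
  define F where "F = (\<lambda>z. Lp_class M p (f z))"
  define K where "K = (SUP z\<in>U. Lp_norm M p (F z))"
  have bdd: "bdd_above ((\<lambda>z. Lp_norm M p (F z)) ` U)" and family: "Lp_family M p U f K"
    unfolding F_def K_def by (rule Lp_familyI[OF assms(1,3-7)]; assumption)+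
  interpret Lp_family M p U f K
    by (rule family)
  note lin = assms(9) and bp = assms(10)
  have norm_\<phi>: "norm (\<phi> g) \<le> Hinf_functional_norm U \<phi>" if "g \<in> Hinf_unit_ball U" for g
    by (rule functional_le_norm[OF U(2) lin bp that])
  have "local_Lp_family M p U f"
    unfolding local_Lp_family_def using family by blast
  note loc = Lp_partials_local_family[OF this, of \<alpha>] cpartials_pairing_local_family[OF this, of _ _ \<alpha>]
  have partials_Lp: "(\<lambda>t. cpartials \<alpha> (\<lambda>w. f w t) z) \<in> Lp_fun M p" if z: "z \<in> U" for z
  proof -
    obtain V K' where V: "z \<in> V" "Lp_family M p V (iterate_partials family_partial \<alpha> f) K'"
      using loc(1) z unfolding local_Lp_family_def by blast
    show ?thesis
      using Lp_family.Lp[OF V(2,1)] by (simp only: iterate_family_partial[abs_def])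
  qed
  have partials_eq: "Lp_partials M p \<alpha> F a = Lp_class M p (\<lambda>t. cpartials \<alpha> (\<lambda>w. f w t) a)"
    using loc(1) assms(8) unfolding F_def by (simp only: iterate_family_partial[abs_def])
  have "norm (Lp_norm M p (F z)) \<le> K" if "z \<in> U" for z
    using cSUP_upper[OF that bdd] by (simp add: K_def Lp_norm_def)
  then have "F \<in> Hinf_Lp M p U"
    using holomorphic_Lp_family by (auto simp: Hinf_Lp_def F_def bounded_iff)
  moreover have "Lp_partials M p \<alpha> F a \<in> Lp M p"
    "(\<lambda>t. cpartials \<alpha> (\<lambda>z. f z t) a) \<in> Lp_partials M p \<alpha> F a"
    unfolding partials_eq using partials_Lp[OF assms(8)] by (auto intro: Lp_class_in_Lp Lp_class_self)
  moreover have "(\<lambda>t. \<phi> (\<lambda>z. f z t)) \<in> Lp_fun M p"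
    by (rule functional_Lp[OF lin bp norm_\<phi>])
  moreover have "(\<integral>t. norm (\<phi> (\<lambda>z. f z t)) powr p \<partial>M) powr (1 / p) \<le> Hinf_functional_norm U \<phi> * K"
    using functional_seminorm[OF lin bp norm_\<phi>] by (simp add: Lp_seminorm_def)
  moreover have "Lp_class M p (\<lambda>t. \<phi> (\<lambda>z. f z t)) \<in> Lp_closed_span M p (F ` U)"
    unfolding F_def by (rule functional_in_closed_span[OF lin bp])
  moreover have "(\<forall>z\<in>U. integrable M (\<lambda>t. f z t * h t)) \<and>
      holomorphic_vec (\<lambda>z. \<integral>t. f z t * h t \<partial>M) U \<and>
      (\<forall>z\<in>U. integrable M (\<lambda>t. cpartials \<alpha> (\<lambda>w. f w t) z * h t) \<and>
        cpartials \<alpha> (\<lambda>w. \<integral>t. f w t * h t \<partial>M) z = (\<integral>t. cpartials \<alpha> (\<lambda>w. f w t) z * h t \<partial>M)) \<and>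
      integrable M (\<lambda>t. \<phi> (\<lambda>z. f z t) * h t) \<and>
      (\<lambda>z. \<integral>t. f z t * h t \<partial>M) \<in> Hinf U \<and>
      (\<integral>t. \<phi> (\<lambda>z. f z t) * h t \<partial>M) = \<phi> (\<lambda>z. \<integral>t. f z t * h t \<partial>M)"
    if hq: "h \<in> Lq_fun M q" for h
  proof -
    obtain N where h: "dual_fun M p N h"
      using Lq_fun_dual_fun[OF assms(1,2) hq] by metis
    have "cpartials \<alpha> (\<lambda>w. \<integral>t. f w t * h t \<partial>M) z = (\<integral>t. cpartials \<alpha> (\<lambda>w. f w t) z * h t \<partial>M)"
      if "z \<in> U" for z
      using loc(2)[OF h] that by (simp only: iterate_family_partial)
    then show ?thesis
      using dual_funD(3)[OF h] Lp partials_Lp functional_Lp[OF lin bp norm_\<phi>] pairing_holomorphic[OF h]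
        pairing_Hinf[OF h] functional_pairing[OF lin bp norm_\<phi> h]
      by simp
  qed
  ultimately show ?thesis
    unfolding Let_def F_def[symmetric] K_def[symmetric] by blast
qed

end
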